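(* Let $\widehat{S}\in\widehat{G}$ be a parabolic isometry such that $\sigma(\widehat{S})=\{\lambda\}$. Then: (1) Up to conjugacy in $\widehat{G}$, $\widehat{S}$ is a Heisenberg translation. (2) There is a two- or three-dimensional subspace $K$ of $H\oplus\mathbb{C}$, non-degenerate for $\widehat{\mathcal{A}}$ and containing a light-like eigenvector of $\widehat S$, such that $H\oplus\mathbb{C}=K\oplus K^{\dagger}$ and $\widehat{S}=\widehat{S}_1\oplus\widehat{S}_2$, where $\widehat{S}_1=\widehat{S}|_K$ and $\widehat{S}_2=\widehat{S}|_{K^{\dagger}}=\lambda I$. The space $\ker(\widehat{S}_1-\lambda I)$ is generated by the light-like eigenvector, and the minimal polynomial of $\widehat{S}_1$ is $(x-\lambda)^2$ or $(x-\lambda)^3$. (3) All the parabolic isometries in $\widehat{G}$ having the same singleton spectrum and for which the restricted minimal polynomial (the minimal polynomial of $\widehat{S}_1$ in (2)) has degree $2$ are dispersed into two conjugacy classes of $\widehat{G}$; those having the same singleton spectrum and restricted minimal polynomial of degree $3$ fall in a single conjugacy class of $\widehat{G}$.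
   Context: $H$ is a complex Hilbert space with inner product $\langle\cdot,\cdot\rangle$ (linear in the first variable), $B$ its open unit ball, $e\in\partial B$ a fixed unit vector; each $x\in H$ is written $x=\langle x,e\rangle e+x'$ with $x'\in\langle e\rangle^{\perp}$. On $H\oplus\mathbb{C}$ consider the Hermitian forms $\mathcal{A}((x,z),(y,w))=\langle x,y\rangle-z\overline{w}$ and $\widehat{\mathcal{A}}((x,z),(y,w))=-z\overline{\langle y,e\rangle}-\langle x,e\rangle\overline{w}+\langle x',y'\rangle$. $G$ (resp. $\widehat{G}$) is the group of all bijective bounded linear operators on $H\oplus\mathbb{C}$ preserving $\mathcal{A}$ (resp. $\widehat{\mathcal{A}}$). Let $D$ be the unitary operator with $D(e,0)=\frac{1}{\sqrt2}(e,1)$, $D(0,1)=\frac{1}{\sqrt2}(-e,1)$, $D=I$ on $\langle e\rangle^{\perp}$; then $\widehat{G}=D^{-1}GD$. Each $T\in G$ acts on $\overline{B}$ by $\widetilde{T}(x)=y/w$ where $T(x,1)=(y,w)$. $T$ is elliptic if $\widetilde{T}$ has a fixed point in $B$, and parabolic if it is not elliptic and $\widetilde{T}$ has exactly one fixed point in $\overline{B}$, lying on $\partial B$. $\widehat{T}=D^{-1}TD\in\widehat{G}$ is called parabolic if $T$ is. A nonzero vector $v$ is light-like if $\widehat{\mathcal{A}}(v,v)=0$. $M^{\dagger}$ denotes the orthogonal complement of $M$ with respect to $\widehat{\mathcal{A}}$. A Heisenberg translation is an element of $\widehat{G}$ of the form, in block form relative to $H\oplus\mathbb{C}=\langle e\rangle\oplus\langle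 e\rangle^{\perp}\oplus\mathbb{C}$, $$(\lambda,a',s)=\lambda\begin{bmatrix}1&\langle\cdot,a'\rangle&s\\0&I&a'\\0&0&1\end{bmatrix},$$ with $|\lambda|=1$, $a'\in\langle e\rangle^{\perp}$, $s\in\mathbb{C}$, $s\neq0$, $\operatorname{Re}s=\frac12\|a'\|^2$. *)

theory Defs
  imports "HOL-Analysis.Analysis" "HOL-Computational_Algebra.Polynomial"
begin

subsection \<open>Complex Hilbert spaces\<close>

class complex_vector = real_vector +
  fixes scaleC :: "complex \<Rightarrow> 'a \<Rightarrow> 'a" (infixr "*C" 75)
  assumes scaleC_add_right: "a *C (x + y) = a *C x + a *C y"
    and scaleC_add_left: "(a + b) *C x = a *C x + b *C x"
    and scaleC_scaleC: "a *C (b *C x) = (a * b) *C x"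
    and scaleC_one: "1 *C x = x"
    and scaleR_scaleC: "scaleR r x = complex_of_real r *C x"

global_interpretation complex_vector: vector_space "scaleC :: complex \<Rightarrow> 'a \<Rightarrow> 'a::complex_vector"
  defines csubspace = complex_vector.subspace
    and cspan = complex_vector.span
    and cdependent = complex_vector.dependent
    and cdim = complex_vector.dim
  by unfold_locales (rule scaleC_add_right scaleC_add_left scaleC_scaleC scaleC_one)+

text \<open>
  The last axiom links the inner product (linear in the first variable) to the norm of the
  complete space; since norms are nonnegative and definite, it also gives positive definiteness.
\<close>

class complex_hilbert = complex_vector + banach +
  fixes cinner :: "'a \<Rightarrow> 'a \<Rightarrow> complex"
  assumes cinner_commute: "cinner x y = cnj (cinner y x)"
    and cinner_add_left: "cinner (x + y) z = cinner x z + cinner y z"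
    and cinner_scaleC_left: "cinner (c *C x) y = c * cinner x y"
    and cinner_self: "cinner x x = complex_of_real ((norm x)\<^sup>2)"

lemma cinner_add_right: "cinner x (y + z) = cinner x y + cinner x (z::'a::complex_hilbert)"
  by (metis cinner_add_left cinner_commute complex_cnj_add)

lemma cinner_scaleC_right: "cinner x (c *C y) = cnj c * cinner x (y::'a::complex_hilbert)"
  by (metis cinner_commute cinner_scaleC_left complex_cnj_mult)

lemma cinner_diff_left: "cinner (x - y) z = cinner x z - cinner y (z::'a::complex_hilbert)"
  by (metis add_diff_cancel_right' cinner_add_left diff_add_cancel)

lemma cinner_diff_right: "cinner x (y - z) = cinner x y - cinner x (z::'a::complex_hilbert)"
  by (metis add_diff_cancel_right' cinner_add_right diff_add_cancel)

instantiation complex :: complex_hilbert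
begin

definition scaleC_complex :: "complex \<Rightarrow> complex \<Rightarrow> complex"
  where "scaleC_complex c x = c * x"

definition cinner_complex :: "complex \<Rightarrow> complex \<Rightarrow> complex"
  where "cinner_complex x y = x * cnj y"

instance
proof
  fix x y z a b :: complex and r :: real
  show "cinner x x = complex_of_real ((norm x)\<^sup>2)"
    unfolding cinner_complex_def by (rule complex_norm_square [symmetric])
qed (simp_all add: scaleC_complex_def cinner_complex_def scaleR_conv_of_real distrib_left
      distrib_right mult.assoc)

end

text \<open>The library norm on a product type is the \<open>\<ell>\<^sup>2\<close> norm, so it is the Hilbert norm of the direct sum.\<close>

instantiation prod :: (complex_vector, complex_vector) complex_vector
begin

definition scaleC_prod :: "complex \<Rightarrow> 'a \<times> 'b \<Rightarrow> 'a \<times> 'b"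
  where "scaleC_prod c p = (c *C fst p, c *C snd p)"

instance
  by standard
    (simp_all add: scaleC_prod_def prod_eq_iff scaleC_add_right scaleC_add_left scaleC_scaleC
      scaleC_one scaleR_scaleC)

end

instantiation prod :: (complex_hilbert, complex_hilbert) complex_hilbert
begin

definition cinner_prod :: "'a \<times> 'b \<Rightarrow> 'a \<times> 'b \<Rightarrow> complex"
  where "cinner_prod p q = cinner (fst p) (fst q) + cinner (snd p) (snd q)"

instance
proof
  fix x y z :: "'a \<times> 'b" and c :: complex
  show "cinner x y = cnj (cinner y x)"
    unfolding cinner_prod_def by (metis cinner_commute complex_cnj_add)
  show "cinner (x + y) z = cinner x z + cinner y z"
    by (simp add: cinner_prod_def cinner_add_left)
  show "cinner (c *C x) y = c * cinner x y"
    by (simp add: cinner_prod_def scaleC_prod_def cinner_scaleC_left distrib_left)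
  show "cinner x x = complex_of_real ((norm x)\<^sup>2)"
    by (simp add: cinner_prod_def cinner_self norm_prod_def)
qed

end


subsection \<open>Bounded operators, spectrum, minimal polynomial\<close>

definition bounded_clinear :: "('a::complex_hilbert \<Rightarrow> 'b::complex_hilbert) \<Rightarrow> bool"
  where "bounded_clinear T \<longleftrightarrow> bounded_linear T \<and> (\<forall>c x. T (c *C x) = c *C T x)"

definition op_spectrum :: "('a::complex_hilbert \<Rightarrow> 'a) \<Rightarrow> complex set"
  where "op_spectrum T =
    {\<mu>. \<not> (\<exists>R. bounded_clinear R \<and> R \<circ> (\<lambda>v. T v - \<mu> *C v) = id \<and> (\<lambda>v. T v - \<mu> *C v) \<circ> R = id)}"

definition eigenvector :: "('a::complex_hilbert \<Rightarrow> 'a) \<Rightarrow> 'a \<Rightarrow> bool"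
  where "eigenvector T v \<longleftrightarrow> v \<noteq> 0 \<and> (\<exists>\<mu>. T v = \<mu> *C v)"

definition poly_op :: "complex poly \<Rightarrow> ('a::complex_hilbert \<Rightarrow> 'a) \<Rightarrow> 'a \<Rightarrow> 'a"
  where "poly_op p T v = (\<Sum>i\<le>degree p. coeff p i *C (T ^^ i) v)"

text \<open>The polynomial \<open>p\<close> is the minimal polynomial of the restriction of \<open>T\<close> to \<open>K\<close>.\<close>

definition is_min_poly_on :: "('a::complex_hilbert \<Rightarrow> 'a) \<Rightarrow> 'a set \<Rightarrow> complex poly \<Rightarrow> bool"
  where "is_min_poly_on T K p \<longleftrightarrow>
    lead_coeff p = 1 \<and> (\<forall>v\<in>K. poly_op p T v = 0) \<and>
    (\<forall>q. q \<noteq> 0 \<and> (\<forall>v\<in>K. poly_op q T v = 0) \<longrightarrow> degree p \<le> degree q)"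


subsection \<open>The two forms, their isometry groups, and the operator connecting them\<close>

definition perp_part :: "'a::complex_hilbert \<Rightarrow> 'a \<Rightarrow> 'a"
  where "perp_part e x = x - cinner x e *C e"

definition form_A :: "'a::complex_hilbert \<times> complex \<Rightarrow> 'a \<times> complex \<Rightarrow> complex"
  where "form_A p q = cinner (fst p) (fst q) - snd p * cnj (snd q)"

definition form_hat :: "'a::complex_hilbert \<Rightarrow> 'a \<times> complex \<Rightarrow> 'a \<times> complex \<Rightarrow> complex"
  where "form_hat e p q =
    - snd p * cnj (cinner (fst q) e) - cinner (fst p) e * cnj (snd q)
    + cinner (perp_part e (fst p)) (perp_part e (fst q))"

definition isometry_group ::
    "('a::complex_hilbert \<times> complex \<Rightarrow> 'a \<times> complex \<Rightarrow> complex)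
      \<Rightarrow> ('a \<times> complex \<Rightarrow> 'a \<times> complex) set"
  where "isometry_group A = {T. bounded_clinear T \<and> bij T \<and> (\<forall>p q. A (T p) (T q) = A p q)}"

abbreviation G :: "('a::complex_hilbert \<times> complex \<Rightarrow> 'a \<times> complex) set"
  where "G \<equiv> isometry_group form_A"

abbreviation G_hat :: "'a::complex_hilbert \<Rightarrow> ('a \<times> complex \<Rightarrow> 'a \<times> complex) set"
  where "G_hat e \<equiv> isometry_group (form_hat e)"

definition D :: "'a::complex_hilbert \<Rightarrow> 'a \<times> complex \<Rightarrow> 'a \<times> complex"
  where "D e p =
    cinner (fst p) e *C (complex_of_real (1 / sqrt 2) *C (e, 1))
    + (perp_part e (fst p), 0)
    + snd p *C (complex_of_real (1 / sqrt 2) *C (- e, 1))"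

definition conj_class :: "('b \<Rightarrow> 'b) set \<Rightarrow> ('b \<Rightarrow> 'b) \<Rightarrow> ('b \<Rightarrow> 'b) set"
  where "conj_class Gr T = {g \<circ> T \<circ> inv g |g. g \<in> Gr}"


subsection \<open>The action on the closed ball; parabolic isometries\<close>

definition ball_action :: "('a::complex_hilbert \<times> complex \<Rightarrow> 'a \<times> complex) \<Rightarrow> 'a \<Rightarrow> 'a"
  where "ball_action T x = (1 / snd (T (x, 1))) *C fst (T (x, 1))"

definition elliptic :: "('a::complex_hilbert \<times> complex \<Rightarrow> 'a \<times> complex) \<Rightarrow> bool"
  where "elliptic T \<longleftrightarrow> (\<exists>x\<in>ball 0 1. ball_action T x = x)"

definition parabolic :: "('a::complex_hilbert \<times> complex \<Rightarrow> 'a \<times> complex) \<Rightarrow> bool"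
  where "parabolic T \<longleftrightarrow>
    \<not> elliptic T \<and> (\<exists>x\<in>sphere 0 1. {y \<in> cball 0 1. ball_action T y = y} = {x})"

definition parabolic_hat ::
    "'a::complex_hilbert \<Rightarrow> ('a \<times> complex \<Rightarrow> 'a \<times> complex) \<Rightarrow> bool"
  where "parabolic_hat e S \<longleftrightarrow> parabolic (D e \<circ> S \<circ> inv (D e))"


subsection \<open>Heisenberg translations\<close>

definition heisenberg ::
    "'a::complex_hilbert \<Rightarrow> complex \<Rightarrow> 'a \<Rightarrow> complex \<Rightarrow> 'a \<times> complex \<Rightarrow> 'a \<times> complex"
  where "heisenberg e l a s p =
    (let x = fst p; z = snd p in
      l *C ((cinner x e + cinner (perp_part e x) a + s * z) *C e + (perp_part e x + z *C a), z))"

definition heisenberg_translation ::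
    "'a::complex_hilbert \<Rightarrow> ('a \<times> complex \<Rightarrow> 'a \<times> complex) \<Rightarrow> bool"
  where "heisenberg_translation e T \<longleftrightarrow>
    T \<in> G_hat e \<and>
    (\<exists>l a s. T = heisenberg e l a s \<and> cmod l = 1 \<and> cinner a e = 0 \<and> s \<noteq> 0 \<and>
      Re s = (norm a)\<^sup>2 / 2)"


subsection \<open>Splitting off a finite-dimensional non-degenerate subspace\<close>

definition light_like :: "'a::complex_hilbert \<Rightarrow> 'a \<times> complex \<Rightarrow> bool"
  where "light_like e v \<longleftrightarrow> v \<noteq> 0 \<and> form_hat e v v = 0"

definition form_perp :: "'a::complex_hilbert \<Rightarrow> ('a \<times> complex) set \<Rightarrow> ('a \<times> complex) set"
  where "form_perp e M = {v. \<forall>m\<in>M. form_hat e v m = 0}"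

definition nondegenerate_on :: "'a::complex_hilbert \<Rightarrow> ('a \<times> complex) set \<Rightarrow> bool"
  where "nondegenerate_on e K \<longleftrightarrow> (\<forall>v\<in>K. (\<forall>w\<in>K. form_hat e v w = 0) \<longrightarrow> v = 0)"

definition direct_sum_decomp :: "'b::complex_vector set \<Rightarrow> 'b set \<Rightarrow> bool"
  where "direct_sum_decomp K L \<longleftrightarrow>
    csubspace K \<and> csubspace L \<and> K \<inter> L = {0} \<and> (\<forall>v. \<exists>k\<in>K. \<exists>m\<in>L. v = k + m)"

definition splitting ::
    "'a::complex_hilbert \<Rightarrow> complex \<Rightarrow> ('a \<times> complex \<Rightarrow> 'a \<times> complex)
      \<Rightarrow> ('a \<times> complex) set \<Rightarrow> 'a \<times> complex \<Rightarrow> bool"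
  where "splitting e l S K u \<longleftrightarrow>
    csubspace K \<and> cdim K \<in> {2, 3} \<and> nondegenerate_on e K \<and>
    u \<in> K \<and> light_like e u \<and> eigenvector S u \<and>
    direct_sum_decomp K (form_perp e K) \<and>
    S ` K \<subseteq> K \<and> S ` form_perp e K \<subseteq> form_perp e K \<and>
    (\<forall>v\<in>form_perp e K. S v = l *C v) \<and>
    {v \<in> K. S v = l *C v} = cspan {u}"

text \<open>
  The parabolic isometries with spectrum \<open>{l}\<close> whose restricted minimal polynomial has degree \<open>d\<close>.
  That degree does not depend on \<open>K\<close>: since \<open>S\<close> is \<open>l\<close> on the complement, the minimal polynomial
  on \<open>K\<close> is the one of \<open>S\<close>.
\<close>

definition parabolic_of_degree ::
    "'a::complex_hilbert \<Rightarrow> complex \<Rightarrow> nat \<Rightarrow> ('a \<times> complex \<Rightarrow> 'a \<times> complex) set"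
  where "parabolic_of_degree e l d =
    {S \<in> G_hat e. parabolic_hat e S \<and> op_spectrum S = {l} \<and>
      (\<exists>K u p. splitting e l S K u \<and> is_min_poly_on S K p \<and> degree p = d)}"


subsection \<open>Properties of the connecting operator\<close>

lemma cinner_perp_part:
  assumes "norm e = 1"
  shows "cinner (perp_part e x) e = 0" "cinner e (perp_part e x) = 0"
proof -
  show "cinner (perp_part e x) e = 0"
    using assms by (simp add: perp_part_def cinner_diff_left cinner_scaleC_left cinner_self)
  then show "cinner e (perp_part e x) = 0"
    by (metis cinner_commute complex_cnj_zero)
qed

lemma D_components:
  "fst (D e p) = ((cinner (fst p) e - snd p) / complex_of_real (sqrt 2)) *C e + perp_part e (fst p)"
  "snd (D e p) = (cinner (fst p) e + snd p) / complex_of_real (sqrt 2)"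
proof -
  have neg: "c *C (- x) = (- c) *C x" for c and x :: 'a
    by (simp add: complex_vector.scale_minus_right complex_vector.scale_minus_left)
  show "fst (D e p) = ((cinner (fst p) e - snd p) / complex_of_real (sqrt 2)) *C e + perp_part e (fst p)"
    by (simp add: D_def scaleC_prod_def scaleC_scaleC neg diff_divide_distrib
        complex_vector.scale_left_diff_distrib complex_vector.scale_minus_left)
  show "snd (D e p) = (cinner (fst p) e + snd p) / complex_of_real (sqrt 2)"
    by (simp add: D_def scaleC_prod_def scaleC_complex_def add_divide_distrib)
qed

lemma D_coordinates:
  assumes "norm e = 1"
  shows "cinner (fst (D e p)) e = (cinner (fst p) e - snd p) / complex_of_real (sqrt 2)"
    and "perp_part e (fst (D e p)) = perp_part e (fst p)"
proof -
  have ee: "cinner e e = 1"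
    using assms by (simp add: cinner_self)
  show *: "cinner (fst (D e p)) e = (cinner (fst p) e - snd p) / complex_of_real (sqrt 2)"
    by (simp add: D_components cinner_add_left cinner_scaleC_left ee cinner_perp_part[OF assms])
  show "perp_part e (fst (D e p)) = perp_part e (fst p)"
    unfolding perp_part_def[of e "fst (D e p)"] * by (simp add: D_components)
qed

lemma cinner_decomp:
  assumes "norm e = 1"
  shows "cinner x y = cinner x e * cnj (cinner y e) + cinner (perp_part e x) (perp_part e y)"
proof -
  have "x = cinner x e *C e + perp_part e x" "y = cinner y e *C e + perp_part e y"
    by (simp_all add: perp_part_def)
  then have "cinner x y = cinner (cinner x e *C e + perp_part e x) (cinner y e *C e + perp_part e y)"
    by simp
  also have "\<dots> = cinner x e * cnj (cinner y e) + cinner (perp_part e x) (perp_part e y)"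
    using assms
    by (simp add: cinner_add_left cinner_add_right cinner_scaleC_left cinner_scaleC_right
        cinner_perp_part cinner_self)
  finally show ?thesis .
qed

lemma form_A_D:
  assumes "norm e = 1"
  shows "form_A (D e p) (D e q) = form_hat e p q"
proof -
  have r: "complex_of_real (sqrt 2) * complex_of_real (sqrt 2) = 2"
    by (metis abs_numeral of_real_mult of_real_numeral real_sqrt_mult_self)
  have *: "(a - b) / r * ((c - d) / r) - (a + b) / r * ((c + d) / r) = - (b * c) - a * d"
    if "r * r = 2" for a b c d r :: complex
    by (simp add: that) (simp add: field_simps)
  show ?thesis
    using *[OF r, of "cinner (fst p) e" "snd p" "cnj (cinner (fst q) e)" "cnj (snd q)"]
    unfolding form_A_def form_hat_def cinner_decomp[OF assms, of "fst (D e p)" "fst (D e q)"]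
      D_coordinates[OF assms] D_components(2)
    by simp
qed

lemma D_unitary:
  assumes "norm e = 1"
  shows "cinner (D e p) (D e q) = cinner p q"
proof -
  have r: "complex_of_real (sqrt 2) * complex_of_real (sqrt 2) = 2"
    by (metis abs_numeral of_real_mult of_real_numeral real_sqrt_mult_self)
  have *: "(a - b) / r * ((c - d) / r) + (a + b) / r * ((c + d) / r) = a * c + b * d"
    if "r * r = 2" for a b c d r :: complex
    by (simp add: that) (simp add: field_simps)
  show ?thesis
    using *[OF r, of "cinner (fst p) e" "snd p" "cnj (cinner (fst q) e)" "cnj (snd q)"]
    unfolding cinner_prod_def cinner_complex_def cinner_decomp[OF assms, of "fst (D e p)" "fst (D e q)"]
      cinner_decomp[OF assms, of "fst p" "fst q"] D_coordinates[OF assms] D_components(2)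
    by (simp add: algebra_simps)
qed

lemma bij_D:
  assumes "norm e = 1"
  shows "bij (D e)"
proof (rule bijI)
  have r: "complex_of_real (sqrt 2) \<noteq> 0" by simp
  have xy: "(x = y) = (cinner x e = cinner y e \<and> perp_part e x = perp_part e y)" for x y
    unfolding perp_part_def by (metis diff_add_cancel)
  show "inj (D e)"
  proof (rule injI)
    fix p q assume eq: "D e p = D e q"
    have "cinner (fst p) e - snd p = cinner (fst q) e - snd q"
      using D_coordinates(1)[OF assms, of p] D_coordinates(1)[OF assms, of q] eq r by simp
    moreover have "cinner (fst p) e + snd p = cinner (fst q) e + snd q"
      using D_components(2)[of e p] D_components(2)[of e q] eq r by simp
    ultimately have c: "cinner (fst p) e = cinner (fst q) e" and s: "snd p = snd q"
      by algebra+
    have "perp_part e (fst p) = perp_part e (fst q)"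
      using D_coordinates(2)[OF assms] eq by metis
    then show "p = q"
      using c s xy[of "fst p" "fst q"] by (simp add: prod_eq_iff)
  qed
  show "surj (D e)"
  proof (rule surjI)
    fix q :: "'a \<times> complex"
    let ?r = "complex_of_real (sqrt 2)"
    let ?a = "(cinner (fst q) e + snd q) / ?r" and ?z = "(snd q - cinner (fst q) e) / ?r"
    let ?p = "(?a *C e + perp_part e (fst q), ?z)"
    have rr: "?r * ?r = 2"
      by (metis abs_numeral of_real_mult of_real_numeral real_sqrt_mult_self)
    have a: "cinner (fst ?p) e = ?a"
      using assms by (simp add: cinner_add_left cinner_scaleC_left cinner_self cinner_perp_part)
    have p: "perp_part e (fst ?p) = perp_part e (fst q)"
      unfolding perp_part_def[of e "fst ?p"] a by simp
    have "(?a - ?z) / ?r = cinner (fst q) e" "(?a + ?z) / ?r = snd q"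
      by (simp_all add: divide_simps rr)
    then show "D e ?p = q"
      unfolding prod_eq_iff D_components p a
      by (simp add: perp_part_def)
  qed
qed

lemma bounded_clinear_comp:
  "bounded_clinear f \<Longrightarrow> bounded_clinear g \<Longrightarrow> bounded_clinear (f \<circ> g)"
  by (auto simp: bounded_clinear_def comp_def intro: bounded_linear_compose)

lemma norm_D:
  assumes "norm e = 1"
  shows "norm (D e p) = norm p"
proof -
  have "complex_of_real ((norm (D e p))\<^sup>2) = complex_of_real ((norm p)\<^sup>2)"
    using D_unitary[OF assms, of p p] by (simp only: cinner_self)
  then show ?thesis
    by (simp only: of_real_eq_iff power2_eq_iff_nonneg norm_ge_zero)
qed

lemma D_add: "D e (p + q) = D e p + D e q"
  by (auto simp: D_def scaleC_prod_def perp_part_def prod_eq_iff cinner_add_left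
      scaleC_add_left add_divide_distrib)

lemma D_scaleC: "D e (c *C p) = c *C D e p"
  by (simp add: D_def scaleC_prod_def scaleC_complex_def perp_part_def prod_eq_iff
      cinner_scaleC_left scaleC_add_right scaleC_scaleC complex_vector.scale_right_diff_distrib
      distrib_left)

lemma bounded_clinear_isometry:
  assumes "\<And>p q. f (p + q) = f p + f q" "\<And>c p. f (c *C p) = c *C f p" "\<And>p. norm (f p) = norm p"
  shows "bounded_clinear f"
  unfolding bounded_clinear_def using assms
  by (auto intro!: bounded_linear_intro[where K = 1] simp: scaleR_scaleC)

lemma bounded_clinear_D:
  assumes "norm e = 1"
  shows "bounded_clinear (D e)" "bounded_clinear (inv (D e))"
proof -
  show "bounded_clinear (D e)"
    by (rule bounded_clinear_isometry) (simp_all add: D_add D_scaleC norm_D assms)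
  have inv: "D e (inv (D e) p) = p" "inv (D e) (D e p) = p" for p
    using bij_D[OF assms] by (simp_all add: bij_def surj_f_inv_f)
  show "bounded_clinear (inv (D e))"
    by (rule bounded_clinear_isometry) (metis D_add inv, metis D_scaleC inv, metis norm_D assms inv)
qed

lemma G_hat_eq:
  assumes "norm e = 1"
  shows "G_hat e = {inv (D e) \<circ> T \<circ> D e |T. T \<in> G}"
proof (intro subset_antisym subsetI)
  have inv: "D e (inv (D e) p) = p" "inv (D e) (D e p) = p" for p
    using bij_D[OF assms] by (simp_all add: bij_def surj_f_inv_f)
  have form_inv: "form_hat e (inv (D e) p) (inv (D e) q) = form_A p q" for p q
    by (metis form_A_D[OF assms] inv(1))
  note bij = bij_D[OF assms] bij_imp_bij_inv[OF bij_D[OF assms]]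
  note bdd = bounded_clinear_D[OF assms]
  {
    fix S assume "S \<in> G_hat e"
    then have "D e \<circ> S \<circ> inv (D e) \<in> G"
      using bij bdd
      by (simp add: isometry_group_def bij_comp bounded_clinear_comp form_A_D[OF assms] form_inv
          del: split_paired_All)
    moreover have "S = inv (D e) \<circ> (D e \<circ> S \<circ> inv (D e)) \<circ> D e"
      by (simp add: fun_eq_iff inv)
    ultimately show "S \<in> {inv (D e) \<circ> T \<circ> D e |T. T \<in> G}"
      by blast
  next
    fix S assume "S \<in> {inv (D e) \<circ> T \<circ> D e |T. T \<in> G}"
    then show "S \<in> G_hat e"
      using bij bdd
      by (auto simp: isometry_group_def bij_comp bounded_clinear_comp form_inv
          form_A_D[OF assms, symmetric] inv simp del: split_paired_All)
  }
qed

end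

theory Submission
  imports Defs
begin

text \<open>
  A parabolic \<open>S\<close> has a light-like eigenvector. The isometry group is transitive on light-like lines,
  so this eigenvector may be taken to be \<open>(e, 0)\<close>, and \<open>S\<close> becomes block triangular. Its middle block is
  a unitary operator of \<open>\<langle>e\<rangle>\<^sup>\<bottom>\<close> with spectrum \<open>{l}\<close>, hence scalar, and preservation of
  the form makes \<open>S\<close> a Heisenberg translation \<open>(l, a, s)\<close>. There \<open>(S - l)\<^sup>2\<close> vanishes exactly if
  \<open>a = 0\<close>, and \<open>(S - l)\<^sup>3 = 0\<close> always, so the degree of the minimal polynomial is 2 or 3.
  Dilations, vertical shifts and unitaries of \<open>\<langle>e\<rangle>\<^sup>\<bottom>\<close> reduce \<open>(l, a, s)\<close> to a single normal form if
  \<open>a \<noteq> 0\<close>, and to \<open>s = i\<close> or \<open>s = -i\<close> if \<open>a = 0\<close>.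
\<close>

subsection \<open>Complex inner products and bounded operators\<close>

text \<open>\<open>D\<close> acts as a Cayley transform: points of the closed ball become lines on
  which \<open>form_hat\<close> is non-positive, boundary points become light-like lines, and the
  boundary point \<open>e\<close> becomes the line of \<open>(e, 0)\<close>. Parabolicity is thus a
  condition on eigenvectors, which conjugation visibly respects. The obstacle is infinite dimension,
  where a one-point spectrum does not give eigenvectors. Scalarity of the middle block is obtained
  by a variational argument in place of the spectral theorem. It is fed with lower bounds for
  \<open>U - \<mu>\<close>, since these pass from \<open>S\<close> to the block once the
  \<open>e\<close>-coordinate is corrected. The number of classes comes from the action on
  \<open>s\<close>. A dilation multiplies \<open>s\<close> by a positive number, so it keeps the
  sign of \<open>Im s\<close>. Conjugation by the translation along \<open>b\<close> shifts
  \<open>s\<close> by the imaginary number \<open>cinner a b - cinner b a\<close>, which takes every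
  imaginary value if \<open>a \<noteq> 0\<close> and is 0 if \<open>a = 0\<close>. The degree is
  defined through some splitting, so its independence of the splitting has to be proved as
  well.\<close>

lemma cinner_zero [simp]: "cinner 0 x = 0" "cinner x 0 = 0"
  by (metis cinner_diff_left diff_self, metis cinner_diff_right diff_self)

lemma cinner_minus: "cinner (- x) y = - cinner x y" "cinner x (- y) = - cinner x y"
  by (metis cinner_diff_left cinner_zero(1) diff_0, metis cinner_diff_right cinner_zero(2) diff_0)

lemmas cinner_simps = cinner_add_left cinner_add_right cinner_diff_left cinner_diff_right
  cinner_scaleC_left cinner_scaleC_right cinner_minus

lemmas scaleC_simps = scaleC_add_right scaleC_scaleC scaleC_one
  complex_vector.scale_right_diff_distrib complex_vector.scale_minus_right

lemmas scaleC_left_simps = scaleC_add_left complex_vector.scale_left_diff_distrib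
  complex_vector.scale_minus_left

lemma Re_cinner_self: "Re (cinner x x) = (norm x)\<^sup>2"
  by (simp add: cinner_self)

lemma cinner_self_eq_0_iff: "cinner x x = 0 \<longleftrightarrow> x = 0"
  by (simp add: cinner_self)

lemma cinner_self_eq_norm_1: "norm x = 1 \<Longrightarrow> cinner x x = 1"
  by (simp add: cinner_self)

lemma cinner_perp_commute: "cinner x y = 0 \<longleftrightarrow> cinner y x = 0"
  by (metis cinner_commute complex_cnj_zero)

lemma norm_scaleC: "norm (c *C x) = cmod c * norm (x::'a::complex_hilbert)"
proof -
  have "complex_of_real ((norm (c *C x))\<^sup>2) = (c * cnj c) * cinner x x"
    by (simp only: cinner_self [symmetric] cinner_simps mult.assoc mult.left_commute)
  also have "\<dots> = complex_of_real ((cmod c * norm x)\<^sup>2)"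
    by (simp only: complex_norm_square [symmetric] cinner_self of_real_mult [symmetric]
        power_mult_distrib)
  finally show ?thesis
    by (simp only: of_real_eq_iff power2_eq_iff_nonneg norm_ge_zero mult_nonneg_nonneg)
qed

lemma norm_diff_squared:
  "(norm (x - y))\<^sup>2 = (norm x)\<^sup>2 - 2 * Re (cinner x y) + (norm (y::'a::complex_hilbert))\<^sup>2"
proof -
  have "Re (cinner y x) = Re (cinner x y)"
    using cinner_commute [of y x] by simp
  then show ?thesis
    by (simp add: Re_cinner_self [symmetric] cinner_simps)
qed

lemma norm_add_squared:
  "(norm (x + y))\<^sup>2 = (norm x)\<^sup>2 + 2 * Re (cinner x y) + (norm (y::'a::complex_hilbert))\<^sup>2"
  using norm_diff_squared [of x "- y"] by (simp add: cinner_simps)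

lemma Cauchy_Schwarz_cinner: "cmod (cinner x y) \<le> norm x * norm (y::'a::complex_hilbert)"
proof (cases "y = 0")
  case False
  define t where "t = cinner x y / complex_of_real ((norm y)\<^sup>2)"
  have ny: "(norm y)\<^sup>2 > 0" using False by simp
  have "cnj t * cinner x y = complex_of_real ((cmod (cinner x y))\<^sup>2 / (norm y)\<^sup>2)"
    by (simp only: t_def complex_cnj_divide complex_cnj_complex_of_real times_divide_eq_left
        mult.commute [of "cnj _"] complex_norm_square [symmetric] of_real_divide)
  then have "Re (cinner x (t *C y)) = (cmod (cinner x y))\<^sup>2 / (norm y)\<^sup>2"
    by (simp only: cinner_simps Re_complex_of_real)
  moreover have "(norm (t *C y))\<^sup>2 = (cmod (cinner x y))\<^sup>2 / (norm y)\<^sup>2"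
    using ny by (simp add: norm_scaleC t_def norm_divide power_mult_distrib power_divide)
      (simp add: power2_eq_square norm_mult)
  moreover have "0 \<le> (norm (x - t *C y))\<^sup>2" by simp
  ultimately have "(cmod (cinner x y))\<^sup>2 / (norm y)\<^sup>2 \<le> (norm x)\<^sup>2"
    by (simp add: norm_diff_squared)
  then have "(cmod (cinner x y))\<^sup>2 \<le> (norm x * norm y)\<^sup>2"
    using ny by (simp add: field_simps)
  then show ?thesis
    by (meson mult_nonneg_nonneg norm_ge_zero power2_le_imp_le)
qed simp

section \<open>Calculus of bounded complex-linear maps\<close>

lemma bounded_clinear_add_apply: "bounded_clinear T \<Longrightarrow> T (p + q) = T p + T q"
  by (simp add: bounded_clinear_def bounded_linear.axioms(1) linear_add bounded_linear.linear)

lemma bounded_clinear_diff_apply: "bounded_clinear T \<Longrightarrow> T (p - q) = T p - T q"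
  by (simp add: bounded_clinear_def linear_diff bounded_linear.linear)

lemma bounded_clinear_zero_apply: "bounded_clinear T \<Longrightarrow> T 0 = 0"
  by (simp add: bounded_clinear_def linear_0 bounded_linear.linear)

lemma bounded_clinear_scaleC_apply: "bounded_clinear T \<Longrightarrow> T (c *C p) = c *C T p"
  by (simp add: bounded_clinear_def)

lemmas bounded_clinear_simps = bounded_clinear_add_apply bounded_clinear_diff_apply
  bounded_clinear_zero_apply bounded_clinear_scaleC_apply

lemma bounded_clinearI:
  assumes "\<And>p q. f (p + q) = f p + f q" "\<And>c p. f (c *C p) = c *C f p"
    and "\<And>p. norm (f p) \<le> norm p * K"
  shows "bounded_clinear f"
  unfolding bounded_clinear_def using assms
  by (auto intro!: bounded_linear_intro [where K = K] simp: scaleR_scaleC)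

lemma bounded_clinear_id: "bounded_clinear (\<lambda>p. p)"
  by (rule bounded_clinear_isometry) simp_all

lemma bounded_clinear_add:
  "bounded_clinear f \<Longrightarrow> bounded_clinear g \<Longrightarrow> bounded_clinear (\<lambda>p. f p + g p)"
  by (simp add: bounded_clinear_def bounded_linear_add scaleC_simps)

lemma bounded_clinear_diff:
  "bounded_clinear f \<Longrightarrow> bounded_clinear g \<Longrightarrow> bounded_clinear (\<lambda>p. f p - g p)"
  by (simp add: bounded_clinear_def bounded_linear_sub scaleC_simps)

lemma bounded_clinear_scaleC: 
  assumes "bounded_clinear f"
  shows "bounded_clinear (\<lambda>p. c *C f p)"
proof -
  have "bounded_clinear (\<lambda>p::'b. c *C p)"
    by (rule bounded_clinearI [where K = "cmod c"])
      (simp_all add: scaleC_simps norm_scaleC mult.commute)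
  from bounded_clinear_comp [OF this assms] show ?thesis
    by (simp add: comp_def)
qed

lemma bounded_clinear_mult: "bounded_clinear f \<Longrightarrow> bounded_clinear (\<lambda>p. c * f p :: complex)"
  using bounded_clinear_scaleC [of f c] by (simp add: scaleC_complex_def)

lemma bounded_clinear_scaleC_left:
  assumes "bounded_clinear f"
  shows "bounded_clinear (\<lambda>p. f p *C v)"
proof -
  have "bounded_clinear (\<lambda>c. c *C v)"
    by (rule bounded_clinearI [where K = "norm v"])
      (simp_all add: scaleC_add_left scaleC_scaleC scaleC_complex_def norm_scaleC)
  from bounded_clinear_comp [OF this assms] show ?thesis
    by (simp add: comp_def)
qed

lemma bounded_clinear_cinner:
  assumes "bounded_clinear f"
  shows "bounded_clinear (\<lambda>p. cinner (f p) v)"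
proof -
  have "bounded_clinear (\<lambda>p. cinner p v)"
    by (rule bounded_clinearI [where K = "norm v"])
      (simp_all add: cinner_simps scaleC_complex_def Cauchy_Schwarz_cinner)
  from bounded_clinear_comp [OF this assms] show ?thesis
    by (simp add: comp_def)
qed

lemma bounded_clinear_fst: "bounded_clinear fst"
  by (simp add: bounded_clinear_def bounded_linear_fst scaleC_prod_def)

lemma bounded_clinear_snd: "bounded_clinear snd"
  by (simp add: bounded_clinear_def bounded_linear_snd scaleC_prod_def)

lemma bounded_clinear_Pair:
  "bounded_clinear f \<Longrightarrow> bounded_clinear g \<Longrightarrow> bounded_clinear (\<lambda>p. (f p, g p))"
  by (simp add: bounded_clinear_def bounded_linear_Pair scaleC_prod_def)

lemmas bounded_clinear_intros = bounded_clinear_id bounded_clinear_add bounded_clinear_diff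
  bounded_clinear_scaleC bounded_clinear_mult bounded_clinear_scaleC_left bounded_clinear_cinner
  bounded_clinear_fst bounded_clinear_snd bounded_clinear_Pair

text \<open>The bound stays a hypothesis here; for isometries of the form the adjoint supplies it,
  without the open mapping theorem.\<close>

lemma bounded_clinear_inv:
  assumes T: "bounded_clinear T" "bij T" and bound: "\<And>p. norm (inv T p) \<le> norm p * K"
  shows "bounded_clinear (inv T)"
proof (rule bounded_clinearI [OF _ _ bound])
  have inv: "T (inv T p) = p" "inv T (T q) = q" for p q
    using T(2) by (simp_all add: bij_is_surj surj_f_inv_f bij_is_inj)
  fix p q c
  have "inv T (T (inv T p + inv T q)) = inv T p + inv T q" by (rule inv)
  then show "inv T (p + q) = inv T p + inv T q"
    by (simp only: bounded_clinear_simps [OF T(1)] inv)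
  have "inv T (T (c *C inv T p)) = c *C inv T p" by (rule inv)
  then show "inv T (c *C p) = c *C inv T p"
    by (simp only: bounded_clinear_simps [OF T(1)] inv)
qed

text \<open>A reflection, aligned by a phase so that it carries one unit vector into the line of another.\<close>

lemma unitary_between_unit_vectors:
  fixes x y :: "'a::complex_hilbert"
  assumes "norm x = 1" "norm y = 1"
  obtains c W where "cmod c = 1" "bounded_clinear W" "W \<circ> W = id" "W x = c *C y"
    "\<And>v w. cinner (W v) (W w) = cinner v w"
    "\<And>v. cinner v x = 0 \<Longrightarrow> cinner v y = 0 \<Longrightarrow> W v = v"
proof -
  \<comment> \<open>The complex reflection along the difference of two distinct unit vectors
    exchanges them only if their inner product is real. The phase arranges this:
    \<open>cinner x (c *C y)\<close> equals \<open>cmod (cinner x y)\<close>.\<close>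
  define c where "c = (if cinner x y = 0 then 1 else sgn (cinner x y))"
  have c1: "cmod c = 1"
    by (simp add: c_def norm_sgn)
  have ccn: "cnj c * cinner x y = complex_of_real (cmod (cinner x y))"
    by (simp add: c_def sgn_div_norm scaleR_conv_of_real complex_norm_square [symmetric]
        divide_simps mult.commute power2_eq_square)
  have cc: "c * cnj c = 1"
    using c1 by (simp add: complex_norm_square [symmetric])
  define u where "u = x - c *C y"
  define n where "n = complex_of_real ((norm u)\<^sup>2)"
  have uu: "cinner u u = n"
    by (simp add: n_def cinner_self)
  have yx: "c * cinner y x = complex_of_real (cmod (cinner x y))"
    by (metis ccn cinner_commute complex_cnj_complex_of_real complex_cnj_mult complex_cnj_cnj)
  have xu: "2 * cinner x u = n"
    unfolding uu [symmetric] using ccn yx cc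
    by (simp add: u_def cinner_simps cinner_self_eq_norm_1 assms algebra_simps)
  \<comment> \<open>If \<open>n = 0\<close>, the quotient is 0 by convention and \<open>W\<close> is
    the identity, as it should be: then \<open>u = 0\<close>, that is,
    \<open>x = c *C y\<close>.\<close>
  define W where "W v = v - (2 * cinner v u / n) *C u" for v
  have n0: "u = 0" if "n = 0"
    using that by (simp add: n_def)
  have ncnj: "cnj n = n"
    by (simp add: n_def)
  show thesis
  proof
    show "cmod c = 1" by fact
    have "bounded_clinear (\<lambda>v. v - ((2 / n) * cinner v u) *C u)"
      by (intro bounded_clinear_intros)
    then show "bounded_clinear W"
      by (simp add: W_def [abs_def])
    show "W \<circ> W = id"
    proof
      fix v
      show "(W \<circ> W) v = id v"
        by (cases "n = 0")
          (auto simp: W_def n0 cinner_simps uu scaleC_left_simps scaleC_simps field_simps)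
    qed
    show "W x = c *C y"
    proof (cases "n = 0")
      case True
      then show ?thesis using n0 by (simp add: W_def u_def)
    next
      case False
      then show ?thesis
        using xu by (simp add: W_def scaleC_one) (simp add: u_def)
    qed
    show "cinner (W v) (W w) = cinner v w" for v w
    proof (cases "n = 0")
      case False
      then show ?thesis
        using cinner_commute [of u w]
        by (simp add: W_def cinner_simps uu ncnj field_simps)
    qed (simp add: W_def)
    show "W v = v" if "cinner v x = 0" "cinner v y = 0" for v
      using that by (simp add: W_def u_def cinner_simps)
  qed
qed

subsection \<open>A unitary operator with one-point spectrum is scalar\<close>

text \<open>
  The case \<open>\<lambda> = 1\<close>. With \<open>M\<close> the maximum of \<open>\<parallel>V x - x\<parallel>\<^sup>2\<close> on the unit sphere, the form
  \<open>Q x = M \<parallel>x\<parallel>\<^sup>2 - \<parallel>V x - x\<parallel>\<^sup>2\<close> is that of the positive operator \<open>M - (V - 1)\<^sup>*(V - 1)\<close>, which up to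
  the unitary factor \<open>V\<close> is \<open>V\<^sup>2 + (M - 2) V + 1 = (V - \<alpha>)(V - \<beta>)\<close> with \<open>\<alpha>, \<beta> \<noteq> 1\<close>.
  It is therefore bounded below, although \<open>Q\<close> has no positive lower bound.
\<close>

lemma unitary_eq_id_of_bounded_below:
  fixes V :: "'a::complex_hilbert \<Rightarrow> 'a"
  assumes add: "\<And>x y. V (x + y) = V x + V y" and scale: "\<And>c x. V (c *C x) = c *C V x"
    and iso: "\<And>x y. cinner (V x) (V y) = cinner x y" and surj: "surj V"
    and below: "\<And>\<mu>. \<mu> \<noteq> 1 \<Longrightarrow> \<exists>c>0. \<forall>x. c * norm x \<le> norm (V x - \<mu> *C x)"
  shows "V x = x"
proof (rule ccontr)
  assume "V x \<noteq> x"
  then have x0: "x \<noteq> 0"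
    using scale [of 0 x] by auto
  have diff: "V (p - q) = V p - V q" for p q
    by (metis add add_diff_cancel_right' diff_add_cancel)
  have nV: "norm (V p) = norm p" for p
  proof -
    have "(norm (V p))\<^sup>2 = (norm p)\<^sup>2"
      by (simp only: Re_cinner_self [symmetric] iso)
    then show ?thesis by simp
  qed
  define A where "A = (\<lambda>p. (norm (V p - p))\<^sup>2) ` {p. norm p = 1}"
  have bdd: "bdd_above A"
    unfolding A_def
  proof (rule bdd_aboveI2)
    fix p :: 'a assume "p \<in> {p. norm p = 1}"
    then have "norm (V p - p) \<le> 2"
      using norm_triangle_ineq4 [of "V p" p] nV by simp
    then have "(norm (V p - p))\<^sup>2 \<le> 2\<^sup>2"
      by (intro power_mono) simp_all
    then show "(norm (V p - p))\<^sup>2 \<le> 4" by simp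
  qed
  define M where "M = Sup A"
  define normalize where "normalize p = complex_of_real (1 / norm p) *C p" for p :: 'a
  have norm_n: "norm (normalize p) = 1" if "p \<noteq> 0" for p
    using that by (simp add: normalize_def norm_scaleC norm_divide)
  have Vn: "(norm (V (normalize p) - normalize p))\<^sup>2 = (norm (V p - p))\<^sup>2 / (norm p)\<^sup>2" for p
  proof -
    have "V (normalize p) - normalize p = complex_of_real (1 / norm p) *C (V p - p)"
      by (simp add: normalize_def scale scaleC_simps)
    then show ?thesis
      by (simp add: norm_scaleC norm_divide power_divide)
  qed
  have leM: "(norm (V p - p))\<^sup>2 \<le> M * (norm p)\<^sup>2" for p
  proof (cases "p = 0")
    case False
    have "(norm (V (normalize p) - normalize p))\<^sup>2 \<le> M"
      unfolding M_def by (intro cSup_upper bdd) (auto simp: A_def norm_n False)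
    then show ?thesis
      using False by (simp add: Vn field_simps)
  qed (use scale [of 0 0] in simp)
  have M: "M > 0"
  proof -
    have "0 < (norm (V x - x))\<^sup>2"
      using \<open>V x \<noteq> x\<close> by simp
    also have "\<dots> \<le> M * (norm x)\<^sup>2" by (rule leM)
    finally show ?thesis
      by (metis not_less mult_nonpos_nonneg zero_le_power2)
  qed
  define Q where "Q p = M * (norm p)\<^sup>2 - (norm (V p - p))\<^sup>2" for p
  define Z where "Z p = V (V p) + complex_of_real (M - 2) *C V p + p" for p
  \<comment> \<open>A Cauchy-Schwarz argument for the non-negative form \<open>Q\<close>. If
    \<open>P\<close> is the operator of \<open>Q\<close>, then \<open>V P = Z\<close>, so the
    \<open>y\<close> below is \<open>P p\<close>, and the claim is the standard bound of
    \<open>P^2\<close> by \<open>M P\<close>. It follows from \<open>Q \<ge> 0\<close> at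
    \<open>p - t y\<close>.\<close>
  have Z_le: "(norm (Z p))\<^sup>2 \<le> M * Q p" for p
  proof -
    obtain y where y: "V y = Z p"
      using surj by (metis surjD)
    have ny: "norm y = norm (Z p)"
      using nV y by metis
    have cross: "Re (M * cinner p y - cinner (V p - p) (V y - y)) = (norm y)\<^sup>2"
    proof -
      have "M * cinner p y - cinner (V p - p) (V y - y) = cinner (Z p) (V y)"
        by (simp add: Z_def cinner_simps iso algebra_simps)
      then show ?thesis
        by (simp add: y ny Re_cinner_self)
    qed
    \<comment> \<open>This value minimises \<open>- 2 * t * N + t^2 * M * N\<close>, where
      \<open>N\<close> is the square of \<open>norm y\<close>.\<close>
    define t where "t = 1 / M"
    let ?y = "complex_of_real t *C y"
    have 1: "V (p - ?y) - (p - ?y) = (V p - p) - complex_of_real t *C (V y - y)"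
      by (simp add: diff scale scaleC_simps)
    have "Q (p - ?y) = Q p - 2 * t * Re (M * cinner p y - cinner (V p - p) (V y - y)) + t\<^sup>2 * Q y"
      unfolding Q_def 1 norm_diff_squared [of p ?y]
        norm_diff_squared [of "V p - p" "complex_of_real t *C (V y - y)"]
        cinner_scaleC_right norm_scaleC power_mult_distrib
      by (simp add: algebra_simps del: complex_vector.scale_right_diff_distrib)
    also have "\<dots> \<le> Q p - 2 * t * (norm y)\<^sup>2 + t\<^sup>2 * (M * (norm y)\<^sup>2)"
      unfolding cross by (intro add_left_mono mult_left_mono) (simp_all add: Q_def)
    also have "\<dots> = Q p - (norm y)\<^sup>2 / M"
      using M by (simp add: t_def power2_eq_square field_simps)
    finally have "(norm y)\<^sup>2 / M \<le> Q p"
      using leM [of "p - ?y"] by (simp add: Q_def)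
    then show ?thesis
      using M by (simp add: ny field_simps)
  qed
  define d where "d = csqrt (complex_of_real ((M - 2)\<^sup>2 - 4))"
  define \<alpha> \<beta> where "\<alpha> = (complex_of_real (2 - M) + d) / 2" and "\<beta> = (complex_of_real (2 - M) - d) / 2"
  have dd: "d * d = complex_of_real ((M - 2)\<^sup>2 - 4)"
    using power2_csqrt by (simp add: d_def power2_eq_square)
  have sum: "\<alpha> + \<beta> = complex_of_real (2 - M)"
    by (simp add: \<alpha>_def \<beta>_def field_simps)
  have prd: "\<alpha> * \<beta> = 1"
  proof -
    have "4 * ((a + b) / 2 * ((a - b) / 2)) = a * a - b * b" for a b :: complex
      by (simp add: square_diff_square_factored)
    then have "4 * (\<alpha> * \<beta>) = complex_of_real ((2 - M) * (2 - M)) - d * d"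
      unfolding \<alpha>_def \<beta>_def of_real_mult .
    also have "\<dots> = 4"
      unfolding dd by (simp add: power2_eq_square algebra_simps)
    finally show ?thesis by simp
  qed
  \<comment> \<open>As the product is 1, one root equal to 1 makes both equal to 1, and the sum then
    gives \<open>M = 0\<close>.\<close>
  have not1: "\<alpha> \<noteq> 1" "\<beta> \<noteq> 1"
    using sum prd M by (auto simp: complex_eq_iff)
  have ZV: "Z p = V (V p - \<beta> *C p) - \<alpha> *C (V p - \<beta> *C p)" for p
  proof -
    have "Z p = V (V p) - (\<alpha> + \<beta>) *C V p + (\<alpha> * \<beta>) *C p"
      unfolding sum prd Z_def by (simp add: scaleC_one scaleC_left_simps)
    then show ?thesis
      by (simp add: diff scale scaleC_simps scaleC_left_simps)
  qed
  obtain c1 c2 where c: "c1 > 0" "\<And>p. c1 * norm p \<le> norm (V p - \<alpha> *C p)"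
      "c2 > 0" "\<And>p. c2 * norm p \<le> norm (V p - \<beta> *C p)"
    using below not1 by meson
  \<comment> \<open>The supremum \<open>M\<close> need not be attained. A unit vector within
    \<open>\<epsilon>\<close> of it has \<open>M * Q p < (c1 * c2)^2\<close>, which contradicts the
    lower bound \<open>c1 * c2\<close> for \<open>norm (Z p)\<close>.\<close>
  define \<epsilon> where "\<epsilon> = (c1 * c2)\<^sup>2 / M"
  have "\<epsilon> > 0" using c M by (simp add: \<epsilon>_def)
  moreover have "A \<noteq> {}"
    using norm_n [OF x0] by (auto simp: A_def)
  ultimately obtain r where "r \<in> A" "M - \<epsilon> < r"
    using less_cSup_iff [OF _ bdd, of "M - \<epsilon>"] by (auto simp: M_def)
  then obtain p where p: "norm p = 1" "M - \<epsilon> < (norm (V p - p))\<^sup>2"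
    by (auto simp: A_def)
  have "c1 * (c2 * norm p) \<le> norm (Z p)"
    unfolding ZV using c by (meson less_imp_le mult_left_mono order_trans)
  then have "(c1 * c2)\<^sup>2 \<le> (norm (Z p))\<^sup>2"
    using c p by (intro power_mono) (simp_all add: mult.assoc)
  also have "\<dots> \<le> M * Q p" by (rule Z_le)
  also have "\<dots> < M * \<epsilon>"
    using p M by (simp add: Q_def)
  also have "\<dots> = (c1 * c2)\<^sup>2"
    using M by (simp add: \<epsilon>_def)
  finally show False by simp
qed

text \<open>Rescaling by \<open>cnj l\<close> moves the exceptional point to 1. Lower bounds are
  assumed instead of a spectrum because they are what a diagonal block inherits from a triangular
  operator.\<close>

lemma unitary_scalar_of_bounded_below:
  fixes U :: "'a::complex_hilbert \<Rightarrow> 'a"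
  assumes add: "\<And>x y. U (x + y) = U x + U y" and scale: "\<And>c x. U (c *C x) = c *C U x"
    and iso: "\<And>x y. cinner (U x) (U y) = cinner x y" and surj: "surj U"
    and l: "cmod l = 1"
    and below: "\<And>\<mu>. \<mu> \<noteq> l \<Longrightarrow> \<exists>c>0. \<forall>x. c * norm x \<le> norm (U x - \<mu> *C x)"
  shows "U x = l *C x"
proof -
  have ll: "l * cnj l = 1" "cnj l * l = 1"
    using l by (simp_all add: complex_norm_square [symmetric] mult.commute)
  have "cnj l *C U x = x"
  proof (rule unitary_eq_id_of_bounded_below [where V = "\<lambda>x. cnj l *C U x"])
    show "surj (\<lambda>x. cnj l *C U x)"
    proof (rule surjI)
      show "cnj l *C U (inv U (l *C y)) = y" for y
        by (simp add: surj_f_inv_f surj scaleC_scaleC ll scaleC_one)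
    qed
    fix \<mu> :: complex assume "\<mu> \<noteq> 1"
    then have "l * \<mu> \<noteq> l" using l by auto
    then obtain c where "c > 0" "\<And>x. c * norm x \<le> norm (U x - (l * \<mu>) *C x)"
      using below by meson
    moreover have "norm (cnj l *C U x - \<mu> *C x) = norm (U x - (l * \<mu>) *C x)" for x
    proof -
      have "cnj l *C U x - \<mu> *C x = cnj l *C (U x - (l * \<mu>) *C x)"
        by (simp add: scaleC_simps mult.assoc [symmetric] ll)
      then show ?thesis by (simp add: norm_scaleC l)
    qed
    ultimately show "\<exists>c>0. \<forall>x. c * norm x \<le> norm (cnj l *C U x - \<mu> *C x)"
      by auto
  qed (simp_all add: add scale iso scaleC_simps cinner_simps ll mult.commute mult.left_commute)
  then have "l *C x = l *C (cnj l *C U x)" by simp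
  then show ?thesis by (simp add: scaleC_scaleC ll scaleC_one)
qed

subsection \<open>Coordinates adapted to \<open>e\<close>\<close>

locale unit_vector =
  fixes e :: "'a::complex_hilbert"
  assumes norm_e: "norm e = 1"
begin

text \<open>Orthogonality of \<open>y\<close> to \<open>e\<close> is not built in, so that the
  vector space operations commute with \<open>coord\<close> unconditionally; it enters only where
  components are read off.\<close>

definition coord :: "complex \<Rightarrow> 'a \<Rightarrow> complex \<Rightarrow> 'a \<times> complex"
  where "coord x y z = (x *C e + y, z)"

lemma coord_cases:
  obtains x y z where "p = coord x y z" "cinner y e = 0"
proof
  show "p = coord (cinner (fst p) e) (perp_part e (fst p)) (snd p)"
    by (simp add: coord_def perp_part_def)
qed (simp add: cinner_perp_part norm_e)

lemma coord_components:
  assumes "cinner y e = 0"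
  shows "cinner (fst (coord x y z)) e = x" "perp_part e (fst (coord x y z)) = y"
    and "snd (coord x y z) = z"
  using assms norm_e by (simp_all add: coord_def perp_part_def cinner_simps cinner_self)

lemma coord_eq_iff:
  assumes "cinner y e = 0" "cinner y' e = 0"
  shows "coord x y z = coord x' y' z' \<longleftrightarrow> x = x' \<and> y = y' \<and> z = z'"
  by (metis assms coord_components)

lemma coord_add: "coord x y z + coord x' y' z' = coord (x + x') (y + y') (z + z')"
  by (simp add: coord_def scaleC_add_left)

lemma coord_diff: "coord x y z - coord x' y' z' = coord (x - x') (y - y') (z - z')"
  by (simp add: coord_def complex_vector.scale_left_diff_distrib)

lemma coord_scaleC: "c *C coord x y z = coord (c * x) (c *C y) (c * z)"
  by (simp add: coord_def scaleC_prod_def scaleC_complex_def scaleC_simps)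

lemma coord_0: "0 = coord 0 0 0"
  by (simp add: coord_def zero_prod_def)

lemma coord_eq_0_iff: "cinner y e = 0 \<Longrightarrow> coord x y z = 0 \<longleftrightarrow> x = 0 \<and> y = 0 \<and> z = 0"
  by (simp add: coord_0 coord_eq_iff)

lemma form_hat_coord:
  assumes "cinner y e = 0" "cinner y' e = 0"
  shows "form_hat e (coord x y z) (coord x' y' z') = - (z * cnj x') - x * cnj z' + cinner y y'"
  by (simp add: form_hat_def coord_components assms)

lemma norm_coord:
  assumes "cinner y e = 0"
  shows "(norm (coord x y z))\<^sup>2 = (cmod x)\<^sup>2 + (norm y)\<^sup>2 + (cmod z)\<^sup>2"
proof -
  have "cinner e y = 0"
    using assms cinner_perp_commute by blast
  then show ?thesis
    using norm_e by (simp add: coord_def norm_prod_def norm_add_squared cinner_simps norm_scaleC)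
qed

lemma heisenberg_coord:
  assumes "cinner y e = 0"
  shows "heisenberg e l a s (coord x y z) =
    coord (l * (x + cinner y a + s * z)) (l *C (y + z *C a)) (l * z)"
  unfolding heisenberg_def Let_def coord_components [OF assms]
  by (simp add: coord_def scaleC_prod_def scaleC_complex_def scaleC_simps)

lemma form_hat_linear:
  "form_hat e (p + p') q = form_hat e p q + form_hat e p' q"
  "form_hat e (p - p') q = form_hat e p q - form_hat e p' q"
  "form_hat e (c *C p) q = c * form_hat e p q"
  "form_hat e p (c *C q) = cnj c * form_hat e p q"
  by (simp_all add: form_hat_def perp_part_def scaleC_prod_def scaleC_complex_def cinner_simps
      algebra_simps)

lemma form_hat_zero [simp]: "form_hat e 0 q = 0"
  using form_hat_linear(2) [of 0 0 q] by simp

text \<open>\<open>J\<close> exchanges the two outer coordinates with a sign and fixes the middle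
  one. It turns statements about the form into statements about the inner product, which is how
  inverses are bounded below.\<close>

lemma form_hat_adjoint:
  "\<exists>J. (\<forall>p q. form_hat e p q = cinner p (J q)) \<and> (\<forall>p. J (J p) = p) \<and> (\<forall>p. norm (J p) = norm p)"
proof -
  define J where "J p = coord (- snd p) (perp_part e (fst p)) (- cinner (fst p) e)" for p
  have J: "J (coord x y z) = coord (- z) y (- x)" if "cinner y e = 0" for x y z
    by (simp add: J_def coord_components that)
  show ?thesis
  proof (intro exI conjI allI)
    fix p q
    obtain x y z where p: "p = coord x y z" "cinner y e = 0" by (rule coord_cases)
    obtain x' y' z' where q: "q = coord x' y' z'" "cinner y' e = 0" by (rule coord_cases)
    have "cinner e y' = 0" using q cinner_perp_commute by blast
    then show "form_hat e p q = cinner p (J q)"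
      using p(2) q(2) norm_e
      by (simp add: p(1) q(1) form_hat_coord J)
        (simp add: coord_def cinner_prod_def cinner_complex_def cinner_simps cinner_self)
    show "J (J p) = p" by (simp add: p J)
    have "(norm (J p))\<^sup>2 = (norm p)\<^sup>2" by (simp add: p J norm_coord)
    then show "norm (J p) = norm p" by simp
  qed
qed

subsection \<open>The isometry group and conjugacy\<close>

lemma G_hatD:
  assumes "T \<in> G_hat e"
  shows "bounded_clinear T" "bij T" "form_hat e (T p) (T q) = form_hat e p q"
  using assms unfolding isometry_group_def by blast+

lemma G_hat_inv_apply:
  assumes "T \<in> G_hat e"
  shows "T (inv T p) = p" "inv T (T p) = p"
  using G_hatD(2) [OF assms] by (simp_all add: bij_is_surj surj_f_inv_f bij_is_inj)

lemma G_hat_eq_iff: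
  assumes "T \<in> G_hat e"
  shows "T p = T q \<longleftrightarrow> p = q" "T p = 0 \<longleftrightarrow> p = 0"
proof -
  show "T p = T q \<longleftrightarrow> p = q" for p q
    by (metis G_hat_inv_apply(2) [OF assms])
  from this [of p 0] show "T p = 0 \<longleftrightarrow> p = 0"
    by (simp add: bounded_clinear_zero_apply [OF G_hatD(1) [OF assms]])
qed

lemma G_hatI:
  assumes "bounded_clinear T" "\<And>p. T (R p) = p" "\<And>p. R (T p) = p"
    and "\<And>p q. form_hat e (T p) (T q) = form_hat e p q"
  shows "T \<in> G_hat e"
proof -
  have "bij T"
    by (rule o_bij [of R]) (simp_all add: fun_eq_iff assms)
  then show ?thesis
    using assms by (simp add: isometry_group_def del: split_paired_All)
qed

lemma G_hat_comp: "T \<in> G_hat e \<Longrightarrow> R \<in> G_hat e \<Longrightarrow> T \<circ> R \<in> G_hat e"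
  by (simp add: isometry_group_def bounded_clinear_comp bij_comp del: split_paired_All)

text \<open>Boundedness of the inverse: \<open>T\<^sup>-\<^sup>1 = J T\<^sup>* J\<close> for the symmetry \<open>J\<close> representing the form.\<close>

lemma G_hat_inv:
  assumes "T \<in> G_hat e"
  shows "inv T \<in> G_hat e"
proof -
  note inv = G_hat_inv_apply [OF assms]
  obtain J where J: "\<And>p q. form_hat e p q = cinner p (J q)" "\<And>p. J (J p) = p"
    "\<And>p. norm (J p) = norm p"
    using form_hat_adjoint by blast
  obtain K where K: "\<And>p. norm (T p) \<le> norm p * K"
    using G_hatD(1) [OF assms] bounded_linear.bounded unfolding bounded_clinear_def by blast
  have "norm (inv T q) \<le> norm q * K" for q
  proof -
    define r where "r = inv T q"
    have "complex_of_real ((norm r)\<^sup>2) = cinner (J r) (J r)"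
      by (simp add: cinner_self J)
    also have "\<dots> = form_hat e (T (J r)) (T r)"
      by (simp only: G_hatD(3) [OF assms]) (simp add: J)
    also have "\<dots> = cinner (T (J r)) (J q)"
      by (simp add: r_def inv J)
    finally have "(norm r)\<^sup>2 = cmod (cinner (T (J r)) (J q))"
      by (metis norm_of_real abs_of_nonneg zero_le_power2)
    also have "\<dots> \<le> norm (T (J r)) * norm (J q)"
      by (rule Cauchy_Schwarz_cinner)
    also have "\<dots> \<le> (norm r * K) * norm q"
      using K [of "J r"] by (simp add: J mult_right_mono)
    finally have "norm r * norm r \<le> norm r * (norm q * K)"
      by (simp add: power2_eq_square mult_ac)
    then show ?thesis
      unfolding r_def [symmetric]
      by (metis K inv(1) mult_le_cancel_left_pos norm_ge_zero norm_zero order_le_less r_def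
          order_trans)
  qed
  then have "bounded_clinear (inv T)"
    by (intro bounded_clinear_inv G_hatD [OF assms])
  moreover have "form_hat e (inv T p) (inv T q) = form_hat e p q" for p q
    using G_hatD(3) [OF assms, of "inv T p" "inv T q"] by (simp add: inv)
  ultimately show ?thesis
    by (intro G_hatI [of _ T]) (simp_all add: inv)
qed

text \<open>An intertwining identity is free of \<open>inv g\<close> and can be checked in
  coordinates; all conjugacies below are proved in this form.\<close>

lemma conj_class_iff:
  "R \<in> conj_class (G_hat e) T \<longleftrightarrow> (\<exists>g\<in>G_hat e. \<forall>p. g (T p) = R (g p))"
proof
  assume "R \<in> conj_class (G_hat e) T"
  then obtain g where "g \<in> G_hat e" "R = g \<circ> T \<circ> inv g"
    by (auto simp: conj_class_def)
  then show "\<exists>g\<in>G_hat e. \<forall>p. g (T p) = R (g p)"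
    using G_hat_inv_apply by (intro bexI [of _ g]) auto
next
  assume "\<exists>g\<in>G_hat e. \<forall>p. g (T p) = R (g p)"
  then obtain g where g: "g \<in> G_hat e" "\<And>p. g (T p) = R (g p)" by blast
  then have "R = g \<circ> T \<circ> inv g"
    by (simp add: fun_eq_iff G_hat_inv_apply [OF g(1)])
  then show "R \<in> conj_class (G_hat e) T"
    using g by (auto simp: conj_class_def)
qed

lemma conj_class_sym:
  assumes "R \<in> conj_class (G_hat e) T"
  shows "T \<in> conj_class (G_hat e) R"
proof -
  obtain g where g: "g \<in> G_hat e" "\<And>p. g (T p) = R (g p)"
    using assms by (auto simp: conj_class_iff)
  have "inv g (R p) = T (inv g p)" for p
    by (metis g G_hat_inv_apply)
  then show ?thesis
    unfolding conj_class_iff using G_hat_inv [OF g(1)] by blast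
qed

lemma conj_class_trans:
  assumes "R \<in> conj_class (G_hat e) T" "Q \<in> conj_class (G_hat e) R"
  shows "Q \<in> conj_class (G_hat e) T"
proof -
  obtain g h where "g \<in> G_hat e" "\<And>p. g (T p) = R (g p)" "h \<in> G_hat e" "\<And>p. h (R p) = Q (h p)"
    using assms by (auto simp: conj_class_iff)
  then show ?thesis
    unfolding conj_class_iff using G_hat_comp [of h g] by (intro bexI [of _ "h \<circ> g"]) auto
qed

subsection \<open>Conjugation invariance\<close>

context
  fixes T R g
  assumes T: "T \<in> G_hat e" and g: "g \<in> G_hat e" and intertwine: "\<And>p. g (T p) = R (g p)"
begin

lemma conj_inverse: "inv g (R p) = T (inv g p)"
  by (metis g intertwine G_hat_inv_apply)

lemma conj_in_G_hat: "R \<in> G_hat e"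
proof -
  have "R = g \<circ> (T \<circ> inv g)"
    by (simp add: fun_eq_iff intertwine G_hat_inv_apply [OF g])
  then show ?thesis
    using G_hat_comp T g G_hat_inv by metis
qed

lemma conj_eigen_iff: "R (g v) = \<mu> *C g v \<longleftrightarrow> T v = \<mu> *C v"
  by (metis G_hatD(1) G_hat_eq_iff(1) bounded_clinear_scaleC_apply g intertwine)

lemma conj_eigenvector_iff: "eigenvector R (g v) \<longleftrightarrow> eigenvector T v"
  by (simp add: eigenvector_def conj_eigen_iff G_hat_eq_iff(2) [OF g])

lemma conj_light_like_iff: "light_like e (g v) \<longleftrightarrow> light_like e v"
  by (simp add: light_like_def G_hatD(3) [OF g] G_hat_eq_iff(2) [OF g])

lemma conj_cspan: "cspan {g u} = g ` cspan {u}"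
  by (auto simp: complex_vector.span_singleton image_iff
      bounded_clinear_scaleC_apply [OF G_hatD(1) [OF g]])

text \<open>Resolvents of \<open>T\<close> are carried to resolvents of \<open>R\<close> by
  \<open>g\<close>. The reverse inclusion arises later from the same fact for
  \<open>inv g\<close>.\<close>

lemma conj_op_spectrum_subset: "op_spectrum R \<subseteq> op_spectrum T"
proof
  fix \<mu> assume \<mu>: "\<mu> \<in> op_spectrum R"
  show "\<mu> \<in> op_spectrum T"
  proof (rule ccontr)
    assume "\<mu> \<notin> op_spectrum T"
    then obtain Q where Q: "bounded_clinear Q"
        "Q \<circ> (\<lambda>v. T v - \<mu> *C v) = id" "(\<lambda>v. T v - \<mu> *C v) \<circ> Q = id"
      by (auto simp: op_spectrum_def)
    have Q': "Q (T v - \<mu> *C v) = v" "T (Q v) - \<mu> *C Q v = v" for v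
      using Q(2,3) by (simp_all add: fun_eq_iff del: split_paired_All)
    let ?Q = "g \<circ> (Q \<circ> inv g)"
    have "bounded_clinear ?Q"
      using G_hatD(1) [OF g] G_hatD(1) [OF G_hat_inv [OF g]] Q(1)
      by (intro bounded_clinear_comp)
    moreover have "?Q (R v - \<mu> *C v) = v" for v
    proof -
      have "inv g (R v - \<mu> *C v) = T (inv g v) - \<mu> *C inv g v"
        by (simp add: bounded_clinear_simps [OF G_hatD(1) [OF G_hat_inv [OF g]]] conj_inverse)
      then show ?thesis
        by (simp add: Q' G_hat_inv_apply [OF g])
    qed
    moreover have "R (?Q v) - \<mu> *C ?Q v = v" for v
    proof -
      have "R (?Q v) - \<mu> *C ?Q v = g (T (Q (inv g v)) - \<mu> *C Q (inv g v))"
        by (simp add: bounded_clinear_simps [OF G_hatD(1) [OF g]] intertwine)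
      then show ?thesis
        by (simp only: Q' G_hat_inv_apply [OF g])
    qed
    ultimately show False
      using \<mu> unfolding op_spectrum_def
      by (auto simp: fun_eq_iff simp del: split_paired_All)
  qed
qed

lemma conj_poly_op: "poly_op p R (g v) = g (poly_op p T v)"
proof -
  have pow: "(R ^^ i) (g v) = g ((T ^^ i) v)" for i
    by (induction i) (simp_all add: intertwine)
  have "linear g"
    using G_hatD(1) [OF g] by (simp add: bounded_clinear_def bounded_linear.linear)
  then show ?thesis
    by (simp add: poly_op_def linear_sum pow bounded_clinear_scaleC_apply [OF G_hatD(1) [OF g]])
qed

lemma conj_is_min_poly_on: "is_min_poly_on T K p \<Longrightarrow> is_min_poly_on R (g ` K) p"
  by (simp add: is_min_poly_on_def conj_poly_op G_hat_eq_iff(2) [OF g])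

lemma conj_form_perp: "form_perp e (g ` K) = g ` form_perp e K"
proof (intro set_eqI iffI)
  fix v assume "v \<in> form_perp e (g ` K)"
  then have "form_hat e (inv g v) m = 0" if "m \<in> K" for m
    using that G_hatD(3) [OF g, of "inv g v" m] by (simp add: form_perp_def G_hat_inv_apply [OF g])
  then have "inv g v \<in> form_perp e K"
    by (simp add: form_perp_def)
  then show "v \<in> g ` form_perp e K"
    by (metis G_hat_inv_apply(1) [OF g] imageI)
qed (auto simp: form_perp_def G_hatD(3) [OF g])

lemma conj_linear: "Vector_Spaces.linear scaleC scaleC g"
  using G_hatD(1) [OF g]
  by unfold_locales (simp_all add: bounded_clinear_simps)

lemma conj_csubspace: "csubspace K \<Longrightarrow> csubspace (g ` K)"
  using conj_linear [folded module_hom_iff_linear] unfolding csubspace_def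
  by (rule module_hom.subspace_image)

lemma conj_cdim: "cdim (g ` K) = cdim K"
proof -
  interpret Vector_Spaces.linear scaleC scaleC g
    by (rule conj_linear)
  obtain B where B: "B \<subseteq> K" "\<not> cdependent B" "K \<subseteq> cspan B" "card B = cdim K"
    by (rule complex_vector.basis_exists)
  have inj: "inj g"
    using G_hatD(2) [OF g] by (rule bij_is_inj)
  have "cdim (g ` K) = card (g ` B)"
  proof (rule complex_vector.dim_unique)
    show "g ` B \<subseteq> g ` K" using B by blast
    show "g ` K \<subseteq> cspan (g ` B)"
      using B(3) by (simp only: cspan_def span_image image_mono)
    show "\<not> cdependent (g ` B)"
      using B(2) inj unfolding cdependent_def
      by (intro independent_injective_image) (auto intro: inj_on_subset)
  qed simp
  also have "\<dots> = cdim K"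
    using B inj by (simp add: card_image inj_on_subset)
  finally show ?thesis .
qed

lemma conj_splitting:
  assumes "splitting e l T K u"
  shows "splitting e l R (g ` K) (g u)"
proof -
  have g_linear: "g (p + q) = g p + g q" "g (c *C p) = c *C g p" for p q c
    by (simp_all add: bounded_clinear_simps [OF G_hatD(1) [OF g]])
  have "direct_sum_decomp (g ` K) (g ` form_perp e K)"
  proof -
    have K: "direct_sum_decomp K (form_perp e K)"
      using assms by (simp add: splitting_def)
    then have "g ` K \<inter> g ` form_perp e K = {0}"
      unfolding direct_sum_decomp_def image_Int [OF bij_is_inj [OF G_hatD(2) [OF g]], symmetric]
      by (simp add: bounded_clinear_simps [OF G_hatD(1) [OF g]])
    moreover have "\<exists>k\<in>g ` K. \<exists>m\<in>g ` form_perp e K. v = k + m" for v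
    proof -
      obtain k m where "k \<in> K" "m \<in> form_perp e K" "inv g v = k + m"
        using K unfolding direct_sum_decomp_def by blast
      then show ?thesis
        by (metis g_linear(1) G_hat_inv_apply(1) [OF g] imageI)
    qed
    ultimately show ?thesis
      using K conj_csubspace by (simp add: direct_sum_decomp_def del: split_paired_All)
  qed
  moreover have "nondegenerate_on e (g ` K)"
    using assms by (simp add: splitting_def nondegenerate_on_def G_hatD(3) [OF g] G_hat_eq_iff(2) [OF g])
  moreover have "{v \<in> g ` K. R v = l *C v} = cspan {g u}"
  proof -
    have "{v \<in> g ` K. R v = l *C v} = g ` {v \<in> K. T v = l *C v}"
      by (auto simp: conj_eigen_iff)
    then show ?thesis
      using assms by (simp add: splitting_def conj_cspan)
  qed
  moreover have "R ` g ` K \<subseteq> g ` K" "R ` g ` form_perp e K \<subseteq> g ` form_perp e K"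
    using assms by (auto simp: splitting_def intertwine [symmetric])
  ultimately show ?thesis
    using assms
    by (simp add: splitting_def conj_cdim conj_csubspace conj_form_perp conj_light_like_iff
        conj_eigenvector_iff conj_eigen_iff)
qed

end

end

subsection \<open>Polynomials in an operator\<close>

lemma poly_op_eq_sum:
  assumes "degree p \<le> n"
  shows "poly_op p T v = (\<Sum>i\<le>n. coeff p i *C (T ^^ i) v)"
  unfolding poly_op_def using assms
  by (intro sum.mono_neutral_left) (auto simp: coeff_eq_0)

lemma poly_op_0 [simp]: "poly_op 0 T v = 0"
  by (simp add: poly_op_def)

text \<open>The Horner step, with the shift moved onto the vector; it makes induction on the
  polynomial available for the algebra of \<open>poly_op\<close>.\<close>

lemma poly_op_pCons: "poly_op (pCons a p) T v = a *C v + poly_op p T (T v)"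
proof -
  have "poly_op (pCons a p) T v = (\<Sum>i\<le>Suc (degree p). coeff (pCons a p) i *C (T ^^ i) v)"
    by (rule poly_op_eq_sum) (simp add: degree_pCons_le)
  also have "\<dots> = a *C v + (\<Sum>i\<le>degree p. coeff p i *C (T ^^ i) (T v))"
    by (simp add: sum.atMost_Suc_shift funpow_swap1 del: sum.atMost_Suc)
  finally show ?thesis
    by (simp add: poly_op_def)
qed

lemma poly_op_add: "poly_op (p + q) T v = poly_op p T v + poly_op q T v"
proof -
  have "poly_op r T v = (\<Sum>i\<le>max (degree p) (degree q). coeff r i *C (T ^^ i) v)"
    if "r \<in> {p, q, p + q}" for r
    using that by (intro poly_op_eq_sum) (auto simp: degree_add_le)
  then show ?thesis
    by (simp add: scaleC_add_left sum.distrib)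
qed

lemma poly_op_smult: "poly_op (smult c p) T v = c *C poly_op p T v"
  using poly_op_eq_sum [OF degree_smult_le, of c p T v]
  by (simp add: poly_op_def complex_vector.scale_sum_right scaleC_scaleC)

context
  fixes T :: "'a::complex_hilbert \<Rightarrow> 'a" and l :: complex
  assumes T: "bounded_clinear T"
begin

lemma poly_op_linear:
  "poly_op p T (v + w) = poly_op p T v + poly_op p T w"
  "poly_op p T (c *C v) = c *C poly_op p T v"
  by (induction p arbitrary: v w)
    (simp_all add: poly_op_pCons bounded_clinear_simps [OF T] scaleC_simps mult.commute)

lemma poly_op_commute: "poly_op p T (T v) = T (poly_op p T v)"
  by (induction p arbitrary: v) (simp_all add: poly_op_pCons bounded_clinear_simps [OF T])

lemma poly_op_mult: "poly_op (p * q) T v = poly_op p T (poly_op q T v)"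
  by (induction p arbitrary: v)
    (simp_all add: poly_op_pCons poly_op_add poly_op_smult poly_op_commute)

lemma poly_op_eigen: "T v = l *C v \<Longrightarrow> poly_op p T v = poly p l *C v"
  by (induction p)
    (simp_all add: poly_op_pCons poly_op_linear scaleC_add_left scaleC_scaleC)

lemma poly_op_linear_power: "poly_op ([:- l, 1:] ^ n) T v = ((\<lambda>v. T v - l *C v) ^^ n) v"
  by (induction n arbitrary: v)
    (simp_all add: one_pCons poly_op_mult poly_op_pCons scaleC_one del: mult_pCons_left)

text \<open>
  Write \<open>q = (x - l)\<^sup>m r\<close> with \<open>r l \<noteq> 0\<close>. If \<open>m < d\<close>, applying \<open>(T - l)\<^bsup>d - 1 - m\<^esup>\<close> to \<open>q(T) w = 0\<close>
  leaves \<open>r(l) (T - l)\<^bsup>d - 1\<^esup> w = 0\<close>.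
\<close>

lemma is_min_poly_on_linear_power:
  assumes nil: "\<And>v. v \<in> K \<Longrightarrow> ((\<lambda>v. T v - l *C v) ^^ Suc d) v = 0"
    and w: "w \<in> K" "((\<lambda>v. T v - l *C v) ^^ d) w \<noteq> 0"
  shows "is_min_poly_on T K ([:- l, 1:] ^ Suc d)"
  unfolding is_min_poly_on_def
proof (intro conjI ballI allI impI)
  show "lead_coeff ([:- l, 1:] ^ Suc d) = 1"
    by (metis lead_coeff_pCons(1) lead_coeff_power lead_coeff_1 one_neq_zero one_pCons power_one)
  show "poly_op ([:- l, 1:] ^ Suc d) T v = 0" if "v \<in> K" for v
    using nil [OF that] by (simp only: poly_op_linear_power)
  fix q assume q: "q \<noteq> 0 \<and> (\<forall>v\<in>K. poly_op q T v = 0)"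
  obtain r where r: "q = [:- l, 1:] ^ order l q * r" "\<not> [:- l, 1:] dvd r"
    using order_decomp [of q l] q by blast
  have "Suc d \<le> order l q"
  proof (rule ccontr)
    assume "\<not> Suc d \<le> order l q"
    then have m: "d = order l q + (d - order l q)" by simp
    define u where "u = ((\<lambda>v. T v - l *C v) ^^ d) w"
    have "((\<lambda>v. T v - l *C v) ^^ Suc d) w = T u - l *C u"
      by (simp add: u_def)
    then have "T u = l *C u"
      using nil [OF w(1)] by simp
    then have "poly r l *C u = poly_op r T u"
      by (simp add: poly_op_eigen)
    also have "\<dots> = poly_op (r * [:- l, 1:] ^ d) T w"
      by (simp add: u_def poly_op_mult poly_op_linear_power)
    also have "r * [:- l, 1:] ^ d = [:- l, 1:] ^ (d - order l q) * q"
      by (subst r(1), subst m) (simp only: power_add mult_ac)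
    also have "poly_op \<dots> T w = 0"
      using q w(1) poly_op_linear(2) [of _ 0 0] by (simp add: poly_op_mult)
    finally show False
      using w(2) r(2) by (simp add: u_def poly_eq_0_iff_dvd)
  qed
  also have "\<dots> \<le> degree q"
    using q order_degree by blast
  finally show "degree ([:- l, 1:] ^ Suc d) \<le> degree q"
    by (simp only: degree_linear_power)
qed

text \<open>For \<open>\<mu> \<noteq> l\<close>, the operator \<open>T - \<mu>\<close> is
  \<open>(l - \<mu>) + M\<close> with \<open>M^3 = 0\<close>, so the Neumann series for its inverse
  stops after three terms. At \<open>l\<close> the eigenvector excludes a left inverse.\<close>

lemma op_spectrum_unipotent:
  assumes nil: "\<And>v. ((\<lambda>v. T v - l *C v) ^^ 3) v = 0" and u: "u \<noteq> 0" "T u = l *C u"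
  shows "op_spectrum T = {l}"
proof -
  have "l \<in> op_spectrum T"
  proof (rule ccontr)
    assume "l \<notin> op_spectrum T"
    then obtain R where R: "bounded_clinear R" "R \<circ> (\<lambda>v. T v - l *C v) = id"
      by (auto simp: op_spectrum_def)
    then have "R (T u - l *C u) = u"
      by (metis comp_apply id_apply)
    then show False
      using u R(1) by (simp add: bounded_clinear_zero_apply)
  qed
  moreover have "\<mu> \<notin> op_spectrum T" if "\<mu> \<noteq> l" for \<mu>
  proof -
    define \<delta> where "\<delta> = 1 / (l - \<mu>)"
    define M where "M v = T v - l *C v" for v
    define R where "R v = \<delta> *C v - (\<delta> ^ 2) *C M v + (\<delta> ^ 3) *C M (M v)" for v
    have \<delta>: "(l - \<mu>) * \<delta> = 1" using that by (simp add: \<delta>_def)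
    have M: "bounded_clinear M"
      unfolding M_def [abs_def] by (intro bounded_clinear_intros T)
    have MMM: "M (M (M v)) = 0" for v
      using nil [of v] by (simp add: M_def eval_nat_numeral)
    have TM: "T v - \<mu> *C v = (l - \<mu>) *C v + M v" for v
      by (simp add: M_def scaleC_left_simps)
    have MR: "M (R v) = R (M v)" for v
      by (simp add: R_def bounded_clinear_simps [OF M])
    have "bounded_clinear R"
      unfolding R_def [abs_def] using bounded_clinear_comp [OF M M]
      by (intro bounded_clinear_intros M) (simp add: comp_def)
    moreover have *: "T (R v) - \<mu> *C R v = v" for v
    proof -
      have "T (R v) - \<mu> *C R v = (l - \<mu>) *C R v + R (M v)"
        by (simp add: TM MR)
      also have "\<dots> = ((l - \<mu>) * \<delta>) *C v - (((l - \<mu>) * \<delta>) * \<delta>) *C M v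
          + (((l - \<mu>) * \<delta>) * \<delta> ^ 2) *C M (M v) + R (M v)"
        unfolding R_def [of v] by (simp only: scaleC_simps power2_eq_square power3_eq_cube mult.assoc)
      finally show ?thesis
        by (simp add: \<delta> R_def MMM scaleC_one)
    qed
    moreover have "R (T v - \<mu> *C v) = v" for v
      using * [of v] \<open>bounded_clinear R\<close>
      by (simp add: TM MR bounded_clinear_simps)
    ultimately show ?thesis
      by (auto simp: op_spectrum_def fun_eq_iff)
  qed
  ultimately show ?thesis by blast
qed

end

context unit_vector
begin

subsection \<open>Parabolicity in terms of eigenvectors\<close>

text \<open>The point \<open>y\<close> of the closed ball corresponds to the line of
  \<open>v y\<close>, on which the form has the sign of \<open>(norm y)^2 - 1\<close>, and fixed
  points correspond to eigenlines. The first condition therefore excludes fixed points inside the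
  ball, and the second says that there is exactly one on the sphere.\<close>

lemma parabolic_hat_iff:
  assumes S: "S \<in> G_hat e"
  shows "parabolic_hat e S \<longleftrightarrow>
    (\<forall>v. eigenvector S v \<longrightarrow> 0 \<le> Re (form_hat e v v)) \<and>
    (\<exists>u. light_like e u \<and> eigenvector S u \<and>
      (\<forall>v. light_like e v \<and> eigenvector S v \<longrightarrow> v \<in> cspan {u}))"
proof -
  define v where "v y = inv (D e) (y, 1)" for y
  define T where "T = D e \<circ> S \<circ> inv (D e)"
  have D_inv: "D e (inv (D e) p) = p" "inv (D e) (D e p) = p" for p
    using bij_D [OF norm_e] by (simp_all add: bij_is_surj surj_f_inv_f bij_is_inj)
  have Dv: "D e (v y) = (y, 1)" for y
    by (simp add: v_def D_inv)
  have D0: "D e p = 0 \<longleftrightarrow> p = 0" for p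
    by (metis D_inv(2) bounded_clinear_D(1) bounded_clinear_zero_apply norm_e)
  have v0: "v y \<noteq> 0" for y
    using D0 [of "v y"] by (auto simp: Dv zero_prod_def)
  have form_v: "form_hat e (v y) (v y) = complex_of_real ((norm y)\<^sup>2 - 1)" for y
    by (simp add: form_A_D [OF norm_e, symmetric] Dv form_A_def cinner_self)
  have v_scale: "v y = k *C v x \<longleftrightarrow> k = 1 \<and> y = x" for k x y
  proof -
    have "v y = k *C v x \<longleftrightarrow> (y, 1) = k *C (x, 1::complex)"
      by (metis D_inv(2) D_scaleC Dv)
    then show ?thesis
      by (auto simp: scaleC_prod_def scaleC_complex_def scaleC_one)
  qed
  \<comment> \<open>The last coordinate of \<open>D e p\<close> cannot vanish on a non-zero
    non-positive vector, and dividing by it gives a point of the closed ball.\<close>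
  have repr: "\<exists>c y. c \<noteq> 0 \<and> p = c *C v y \<and> norm y \<le> 1"
    if p: "p \<noteq> 0" "Re (form_hat e p p) \<le> 0" for p
  proof -
    obtain y z where yz: "D e p = (y, z)" by fastforce
    have "Re (form_A (D e p) (D e p)) \<le> 0"
      using p(2) by (simp add: form_A_D norm_e)
    then have le: "(norm y)\<^sup>2 \<le> (cmod z)\<^sup>2"
      by (simp add: yz form_A_def cinner_self complex_norm_square [symmetric])
    have z: "z \<noteq> 0"
      using le D0 [of p] p(1) by (auto simp: yz zero_prod_def)
    have "D e p = D e (z *C v ((1 / z) *C y))"
      using z unfolding D_scaleC Dv yz by (simp add: scaleC_prod_def scaleC_complex_def scaleC_simps)
    then have "p = z *C v ((1 / z) *C y)"
      by (metis D_inv(2))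
    moreover have "norm ((1 / z) *C y) \<le> 1"
      using le z by (simp add: norm_scaleC norm_divide abs_le_square_iff [symmetric] divide_simps)
    ultimately show ?thesis
      using z by blast
  qed
  have eigen_scaleI: "eigenvector S (c *C p)" if c: "c \<noteq> 0" and p: "eigenvector S p" for c p
  proof -
    obtain \<mu> where "S p = \<mu> *C p" "p \<noteq> 0"
      using p by (auto simp: eigenvector_def)
    then have "S (c *C p) = \<mu> *C (c *C p)" "c *C p \<noteq> 0"
      using c by (simp_all add: bounded_clinear_scaleC_apply [OF G_hatD(1) [OF S]] mult.commute)
    then show ?thesis
      unfolding eigenvector_def by blast
  qed
  have eigen_scale: "eigenvector S (c *C p) \<longleftrightarrow> eigenvector S p" if "c \<noteq> 0" for c p
    using eigen_scaleI [of c p] eigen_scaleI [of "1 / c" "c *C p"] that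
    by (auto simp: scaleC_one)
  have fixed: "ball_action T y = y \<longleftrightarrow> eigenvector S (v y)" if y: "norm y \<le> 1" for y
  proof -
    have Ty: "T (y, 1) = D e (S (v y))"
      by (simp add: T_def v_def)
    obtain y1 w where yw: "D e (S (v y)) = (y1, w)" by fastforce
    have "form_A (D e (S (v y))) (D e (S (v y))) = complex_of_real ((norm y)\<^sup>2 - 1)"
      by (simp add: form_A_D [OF norm_e] G_hatD(3) [OF S] form_v)
    then have "complex_of_real ((norm y1)\<^sup>2 - (cmod w)\<^sup>2) = complex_of_real ((norm y)\<^sup>2 - 1)"
      by (simp only: yw form_A_def cinner_self fst_conv snd_conv of_real_diff complex_norm_square)
    moreover have "(norm y)\<^sup>2 \<le> 1"
      using y by (simp add: power_le_one)
    ultimately have le: "(norm y1)\<^sup>2 \<le> (cmod w)\<^sup>2"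
      by (simp only: of_real_eq_iff)
    \<comment> \<open>This makes the division in \<open>ball_action\<close> genuine:
      \<open>S\<close> keeps the vector non-positive, so a vanishing last coordinate would make the
      whole vector vanish.\<close>
    have w: "w \<noteq> 0"
    proof
      assume "w = 0"
      then have "D e (S (v y)) = 0"
        using le by (simp add: yw zero_prod_def)
      then show False
        using v0 by (simp only: D0 G_hat_eq_iff(2) [OF S])
    qed
    have "(1 / w) *C y1 = y' \<longleftrightarrow> y1 = w *C y'" for y'
      using w by (auto simp: scaleC_one)
    then have "ball_action T y = y \<longleftrightarrow> y1 = w *C y"
      by (simp only: ball_action_def Ty yw fst_conv snd_conv)
    also have "\<dots> \<longleftrightarrow> (\<exists>\<mu>. D e (S (v y)) = D e (\<mu> *C v y))"
      unfolding D_scaleC Dv yw by (simp add: scaleC_prod_def scaleC_complex_def)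
    also have "\<dots> \<longleftrightarrow> eigenvector S (v y)"
      using v0 by (simp add: eigenvector_def inj_eq [OF bij_is_inj [OF bij_D [OF norm_e]]])
    finally show ?thesis .
  qed
  have par: "parabolic_hat e S \<longleftrightarrow> (\<forall>y. norm y < 1 \<longrightarrow> \<not> eigenvector S (v y)) \<and>
      (\<exists>x. norm x = 1 \<and> eigenvector S (v x) \<and> (\<forall>y. norm y \<le> 1 \<longrightarrow> eigenvector S (v y) \<longrightarrow> y = x))"
  proof -
    have 1: "elliptic T \<longleftrightarrow> (\<exists>y. norm y < 1 \<and> eigenvector S (v y))"
      unfolding elliptic_def Bex_def mem_ball_0 using fixed less_imp_le by blast
    have "{y \<in> cball 0 1. ball_action T y = y} = {y. norm y \<le> 1 \<and> eigenvector S (v y)}"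
      unfolding mem_cball_0 using fixed by blast
    then have "(\<exists>x\<in>sphere 0 1. {y \<in> cball 0 1. ball_action T y = y} = {x}) \<longleftrightarrow>
        (\<exists>x. norm x = 1 \<and> {y. norm y \<le> 1 \<and> eigenvector S (v y)} = {x})"
      by (simp only: Bex_def mem_sphere_0)
    also have "\<dots> \<longleftrightarrow>
      (\<exists>x. norm x = 1 \<and> eigenvector S (v x) \<and> (\<forall>y. norm y \<le> 1 \<longrightarrow> eigenvector S (v y) \<longrightarrow> y = x))"
      using eq_refl [of "norm _" 1] by (intro ex_cong1 conj_cong refl) blast
    finally show ?thesis
      unfolding parabolic_hat_def T_def [symmetric] parabolic_def 1 by blast
  qed
  show ?thesis
  proof
    assume "parabolic_hat e S"
    then obtain x where ball: "\<And>y. norm y < 1 \<Longrightarrow> \<not> eigenvector S (v y)"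
      and x: "norm x = 1" "eigenvector S (v x)"
      and uniq: "\<And>y. norm y \<le> 1 \<Longrightarrow> eigenvector S (v y) \<Longrightarrow> y = x"
      unfolding par by blast
    have "0 \<le> Re (form_hat e p p)" if p: "eigenvector S p" for p
    proof (rule ccontr)
      assume neg: "\<not> 0 \<le> Re (form_hat e p p)"
      then obtain c y where cy: "c \<noteq> 0" "p = c *C v y" "norm y \<le> 1"
        using repr [of p] p by (auto simp: eigenvector_def)
      then have "y = x"
        using uniq p eigen_scale by blast
      then show False
        using neg x(1) by (simp add: cy form_hat_linear form_v)
    qed
    moreover have "p \<in> cspan {v x}" if p: "light_like e p" "eigenvector S p" for p
    proof -
      obtain c y where cy: "c \<noteq> 0" "p = c *C v y" "norm y \<le> 1"
        using repr [of p] p(1) by (auto simp: light_like_def)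
      then have "y = x"
        using uniq p eigen_scale by blast
      then show ?thesis
        unfolding complex_vector.span_singleton cy by (metis rangeI)
    qed
    moreover have "light_like e (v x)"
      using x(1) v0 by (simp add: light_like_def form_v)
    ultimately show "(\<forall>v. eigenvector S v \<longrightarrow> 0 \<le> Re (form_hat e v v)) \<and>
        (\<exists>u. light_like e u \<and> eigenvector S u \<and>
          (\<forall>v. light_like e v \<and> eigenvector S v \<longrightarrow> v \<in> cspan {u}))"
      using x(2) by blast
  next
    assume "(\<forall>v. eigenvector S v \<longrightarrow> 0 \<le> Re (form_hat e v v)) \<and>
        (\<exists>u. light_like e u \<and> eigenvector S u \<and>
          (\<forall>v. light_like e v \<and> eigenvector S v \<longrightarrow> v \<in> cspan {u}))"
    then obtain u where pos: "\<And>p. eigenvector S p \<Longrightarrow> 0 \<le> Re (form_hat e p p)"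
      and u: "light_like e u" "eigenvector S u"
      and uniq: "\<And>p. light_like e p \<Longrightarrow> eigenvector S p \<Longrightarrow> p \<in> cspan {u}"
      by blast
    have ge1: "1 \<le> norm y" if "eigenvector S (v y)" for y
    proof (rule ccontr)
      assume "\<not> 1 \<le> norm y"
      then have "(norm y)\<^sup>2 < 1" by (simp add: power_less_one_iff)
      then show False using pos [OF that] by (simp add: form_v)
    qed
    obtain c x where cx: "c \<noteq> 0" "u = c *C v x" "norm x \<le> 1"
      using repr [of u] u(1) by (auto simp: light_like_def)
    have Ex: "eigenvector S (v x)"
      using u(2) cx eigen_scale by blast
    moreover have "y = x" if y: "norm y \<le> 1" "eigenvector S (v y)" for y
    proof -
      have "norm y = 1" using ge1 y by force
      then have "v y \<in> cspan {u}"
        using y v0 by (intro uniq) (simp_all add: light_like_def form_v)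
      then obtain k where "v y = k *C (c *C v x)"
        by (auto simp: complex_vector.span_singleton cx)
      then show ?thesis
        using v_scale by (simp add: scaleC_scaleC)
    qed
    moreover have "norm x = 1"
      using ge1 [OF Ex] cx(3) by simp
    ultimately show "parabolic_hat e S"
      unfolding par using ge1 by (meson not_less)
  qed
qed

lemma conj_parabolic_hat:
  assumes T: "T \<in> G_hat e" and g: "g \<in> G_hat e" "\<And>p. g (T p) = R (g p)"
    and par: "parabolic_hat e T"
  shows "parabolic_hat e R"
proof -
  note conj = conj_eigenvector_iff [OF T g] conj_light_like_iff [OF T g]
  have R: "R \<in> G_hat e"
    using T g by (rule conj_in_G_hat)
  obtain u where pos: "\<And>p. eigenvector T p \<Longrightarrow> 0 \<le> Re (form_hat e p p)"
    and u: "light_like e u" "eigenvector T u"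
    and uniq: "\<And>p. light_like e p \<Longrightarrow> eigenvector T p \<Longrightarrow> p \<in> cspan {u}"
    using par unfolding parabolic_hat_iff [OF T] by blast
  have "0 \<le> Re (form_hat e p p)" if "eigenvector R p" for p
    using pos [of "inv g p"] that conj(1) [of "inv g p"] G_hatD(3) [OF g(1), of "inv g p" "inv g p"]
    by (simp add: G_hat_inv_apply [OF g(1)])
  moreover have "p \<in> cspan {g u}" if p: "eigenvector R p" "light_like e p" for p
  proof -
    have "inv g p \<in> cspan {u}"
      using p uniq [of "inv g p"] conj [of "inv g p"] by (simp add: G_hat_inv_apply [OF g(1)])
    then show ?thesis
      unfolding conj_cspan [OF T g] by (metis G_hat_inv_apply(1) [OF g(1)] imageI)
  qed
  moreover have "light_like e (g u)" "eigenvector R (g u)"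
    using u conj by simp_all
  ultimately show ?thesis
    unfolding parabolic_hat_iff [OF R] by blast
qed

lemma conj_op_spectrum:
  assumes T: "T \<in> G_hat e" and g: "g \<in> G_hat e" "\<And>p. g (T p) = R (g p)"
  shows "op_spectrum R = op_spectrum T"
proof
  show "op_spectrum R \<subseteq> op_spectrum T"
    using assms by (rule conj_op_spectrum_subset)
  show "op_spectrum T \<subseteq> op_spectrum R"
    using conj_op_spectrum_subset [OF conj_in_G_hat [OF assms] G_hat_inv [OF g(1)]]
      conj_inverse [OF assms] by blast
qed

lemma parabolic_of_degree_conj:
  assumes "R \<in> conj_class (G_hat e) T" "T \<in> parabolic_of_degree e l d"
  shows "R \<in> parabolic_of_degree e l d"
proof -
  obtain g where g: "g \<in> G_hat e" "\<And>p. g (T p) = R (g p)"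
    using assms(1) by (auto simp: conj_class_iff)
  obtain K u p where T: "T \<in> G_hat e" "parabolic_hat e T" "op_spectrum T = {l}"
    "splitting e l T K u" "is_min_poly_on T K p" "degree p = d"
    using assms(2) by (auto simp: parabolic_of_degree_def)
  then show ?thesis
    using conj_in_G_hat [OF T(1) g] conj_parabolic_hat [OF T(1) g] conj_op_spectrum [OF T(1) g]
      conj_splitting [OF T(1) g] conj_is_min_poly_on [OF T(1) g]
    unfolding parabolic_of_degree_def by blast
qed

text \<open>\<open>parabolic_of_degree\<close> allows any splitting, so the minimal polynomial has
  to be found on an arbitrary \<open>K\<close>. The exponent \<open>Suc d\<close> contains at least
  one factor \<open>S - l\<close>, which kills the component of \<open>w\<close> in the complement;
  the component in \<open>K\<close> then serves as a test vector.\<close>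

lemma is_min_poly_on_splitting:
  assumes "S \<in> G_hat e" "splitting e l S K u"
    and nil: "\<And>v. ((\<lambda>v. S v - l *C v) ^^ Suc (Suc d)) v = 0"
    and w: "((\<lambda>v. S v - l *C v) ^^ Suc d) w \<noteq> 0"
  shows "is_min_poly_on S K ([:- l, 1:] ^ Suc (Suc d))"
proof -
  have S: "bounded_clinear S" using assms(1) by (rule G_hatD)
  have split: "direct_sum_decomp K (form_perp e K)" "\<forall>v\<in>form_perp e K. S v = l *C v"
    using assms(2) unfolding splitting_def by blast+
  obtain k m where km: "k \<in> K" "m \<in> form_perp e K" "w = k + m"
    using split(1) unfolding direct_sum_decomp_def by blast
  have "S m = l *C m"
    using split(2) km(2) by (rule bspec)
  then have "S w - l *C w = S k - l *C k"
    by (simp add: km bounded_clinear_simps [OF S] scaleC_simps)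
  then have "((\<lambda>v. S v - l *C v) ^^ Suc d) k \<noteq> 0"
    using w by (simp del: funpow.simps(2) add: funpow_Suc_right)
  then show ?thesis
    using S nil km(1) by (intro is_min_poly_on_linear_power)
qed

lemma is_min_poly_on_degree_unique:
  assumes "is_min_poly_on S K p" "is_min_poly_on S K q"
  shows "degree p = degree q"
proof -
  have "p \<noteq> 0" "q \<noteq> 0"
    using assms by (auto simp: is_min_poly_on_def)
  then have "degree p \<le> degree q" "degree q \<le> degree p"
    using assms unfolding is_min_poly_on_def by blast+
  then show ?thesis by simp
qed

subsection \<open>Heisenberg translations\<close>

lemma bounded_clinear_heisenberg: "bounded_clinear (heisenberg e l a s)"
  unfolding heisenberg_def [abs_def] Let_def perp_part_def
  by (intro bounded_clinear_intros)

text \<open>The Heisenberg group law. The asymmetric term \<open>cinner b a\<close> is the source of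
  non-commutativity and later makes \<open>Im s\<close> adjustable by conjugation.\<close>

lemma heisenberg_compose:
  assumes "cinner a e = 0" "cinner b e = 0"
  shows "heisenberg e l a s (heisenberg e m b t p) =
    heisenberg e (l * m) (b + a) (t + s + cinner b a) p"
proof -
  obtain x y z where p: "p = coord x y z" "cinner y e = 0" by (rule coord_cases)
  show ?thesis
    using assms p(2)
    by (simp add: p(1) heisenberg_coord cinner_simps)
      (simp add: algebra_simps scaleC_simps)
qed

lemma heisenberg_one: "heisenberg e 1 0 0 p = p"
proof -
  obtain x y z where p: "p = coord x y z" "cinner y e = 0" by (rule coord_cases)
  show ?thesis
    using p(2) by (simp add: p(1) heisenberg_coord scaleC_one)
qed

lemma coord_unit_eigen: "heisenberg e l a s (coord 1 0 0) = l *C coord 1 0 0"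
  by (simp add: heisenberg_coord coord_scaleC)

lemma csubspace_form_perp: "csubspace (form_perp e M)"
  by (rule complex_vector.subspaceI) (simp_all add: form_perp_def form_hat_linear)

context
  fixes l :: complex and a :: 'a and s :: complex
  assumes l: "cmod l = 1" and a: "cinner a e = 0" and s: "Re s = (norm a)\<^sup>2 / 2"
begin

lemma l_cnj: "l * cnj l = 1" "cnj l * l = 1" "l \<noteq> 0"
  using l by (auto simp: complex_norm_square [symmetric] mult.commute [of "cnj l"])

lemma s_cnj: "s + cnj s = cinner a a"
  using s by (simp add: complex_eq_iff cinner_self)

text \<open>The relation \<open>s + cnj s = cinner a a\<close> does two things: in the composition
  law it makes the triple \<open>cnj l\<close>, \<open>- a\<close>, \<open>cnj s\<close> the
  inverse, and it cancels the only defect in the preservation of the form.\<close>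

lemma heisenberg_in_G_hat: "heisenberg e l a s \<in> G_hat e"
proof (rule G_hatI [where R = "heisenberg e (cnj l) (- a) (cnj s)"])
  show "bounded_clinear (heisenberg e l a s)"
    by (rule bounded_clinear_heisenberg)
  have a': "cinner (- a) e = 0"
    using a by (simp add: cinner_simps)
  show "heisenberg e l a s (heisenberg e (cnj l) (- a) (cnj s) p) = p" for p
    using s_cnj by (simp add: heisenberg_compose a a' l_cnj cinner_simps add.commute heisenberg_one)
  show "heisenberg e (cnj l) (- a) (cnj s) (heisenberg e l a s p) = p" for p
    using s_cnj by (simp add: heisenberg_compose a a' l_cnj cinner_simps heisenberg_one)
  fix p q
  obtain x y z where p: "p = coord x y z" "cinner y e = 0" by (rule coord_cases)
  obtain x' y' z' where q: "q = coord x' y' z'" "cinner y' e = 0" by (rule coord_cases)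
  have *: "form_hat e (l *C v) (l *C w) = form_hat e v w" for v w
    by (simp add: form_hat_linear mult.assoc [symmetric] l_cnj)
  have H: "heisenberg e l a s (coord x y z) = l *C coord (x + cinner y a + s * z) (y + z *C a) z"
    if "cinner y e = 0" for x y z
    using that by (simp add: heisenberg_coord coord_scaleC)
  have "cnj (cinner y' a) = cinner a y'"
    by (metis cinner_commute)
  then have "form_hat e (heisenberg e l a s p) (heisenberg e l a s q) =
      form_hat e p q + z * cnj z' * (cinner a a - (s + cnj s))"
    using p(2) q(2) a
    by (simp add: p(1) q(1) H * form_hat_coord cinner_simps algebra_simps)
  then show "form_hat e (heisenberg e l a s p) (heisenberg e l a s q) = form_hat e p q"
    by (simp add: s_cnj)
qed

lemma heisenberg_nilpotent_part:
  "cinner y e = 0 \<Longrightarrow> heisenberg e l a s (coord x y z) - l *C coord x y z =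
    coord (l * (cinner y a + s * z)) ((l * z) *C a) 0"
  by (simp add: heisenberg_coord coord_scaleC coord_diff scaleC_simps algebra_simps)

lemma heisenberg_nilpotent_part_2:
  "cinner y e = 0 \<Longrightarrow> ((\<lambda>v. heisenberg e l a s v - l *C v) ^^ 2) (coord x y z) =
    coord (l\<^sup>2 * z * cinner a a) 0 0"
  using a by (simp add: numeral_2_eq_2 heisenberg_nilpotent_part cinner_simps mult.assoc)

lemma heisenberg_nilpotent_part_3: "((\<lambda>v. heisenberg e l a s v - l *C v) ^^ 3) p = 0"
proof -
  obtain x y z where p: "p = coord x y z" "cinner y e = 0" by (rule coord_cases)
  have "((\<lambda>v. heisenberg e l a s v - l *C v) ^^ Suc 2) p = 0"
    unfolding p(1) funpow.simps(2) comp_apply heisenberg_nilpotent_part_2 [OF p(2)]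
    by (simp add: heisenberg_nilpotent_part coord_0)
  then show ?thesis by (simp only: eval_nat_numeral)
qed

lemma op_spectrum_heisenberg: "op_spectrum (heisenberg e l a s) = {l}"
  using heisenberg_nilpotent_part_3 _ coord_unit_eigen
  by (rule op_spectrum_unipotent [OF bounded_clinear_heisenberg]) (simp add: coord_eq_0_iff)

text \<open>The hyperbolic plane of \<open>coord 1 0 0\<close> and \<open>coord 0 0 1\<close>,
  enlarged by the direction \<open>a\<close> into which the translation moves
  \<open>coord 0 0 1\<close>. For \<open>a = 0\<close> it collapses to the plane, so one definition
  serves dimensions 2 and 3.\<close>

definition "split_space = {coord x (c *C a) z |x c z. True}"

lemma split_spaceI: "coord x (c *C a) z \<in> split_space"
  by (auto simp: split_space_def)

lemma split_space_basis:
  "coord 1 0 0 \<in> split_space" "coord 0 0 1 \<in> split_space" "coord 0 a 0 \<in> split_space"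
  using split_spaceI [of 1 0 0] split_spaceI [of 0 0 1] split_spaceI [of 0 1 0]
  by (simp_all add: scaleC_one)

lemma csubspace_split_space: "csubspace split_space"
proof (rule complex_vector.subspaceI)
  show "0 \<in> split_space"
    using split_spaceI [of 0 0 0] by (simp add: coord_0)
  show "v + w \<in> split_space" if "v \<in> split_space" "w \<in> split_space" for v w
    using that by (auto simp: split_space_def coord_add scaleC_add_left [symmetric]) blast
  show "c *C v \<in> split_space" if "v \<in> split_space" for c v
    using that by (auto simp: split_space_def coord_scaleC scaleC_scaleC) blast
qed

lemma cdim_split_space: "cdim split_space = (if a = 0 then 2 else 3)"
proof (rule complex_vector.dim_unique)
  define A where "A = (if a = 0 then {} else {coord 0 a 0})"
  define B where "B = insert (coord 0 0 1) (insert (coord 1 0 0) A)"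
  show "B \<subseteq> split_space"
    using split_space_basis by (auto simp: B_def A_def)
  show "split_space \<subseteq> cspan B"
  proof
    fix v assume "v \<in> split_space"
    then obtain x c z where "v = coord x (c *C a) z"
      by (auto simp: split_space_def)
    then have "v = x *C coord 1 0 0 + c *C coord 0 a 0 + z *C coord 0 0 1"
      by (simp add: coord_scaleC coord_add)
    moreover have "coord 0 a 0 \<in> cspan B"
      by (cases "a = 0")
        (auto simp: coord_0 [symmetric] complex_vector.span_zero B_def A_def
          intro: complex_vector.span_base)
    ultimately show "v \<in> cspan B"
      by (auto simp: B_def intro!: complex_vector.span_add complex_vector.span_scale
          intro: complex_vector.span_base)
  qed
  have A: "\<not> cdependent A" "coord 1 0 0 \<notin> cspan A"
    using a by (auto simp: A_def complex_vector.independent_empty complex_vector.span_singleton coord_scaleC coord_eq_iff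
        coord_eq_0_iff cinner_simps)
  have "coord 0 0 1 \<notin> cspan (insert (coord 1 0 0) A)"
  proof
    have "csubspace {v :: 'a \<times> complex. snd v = 0}"
      by (rule complex_vector.subspaceI) (auto simp: scaleC_prod_def scaleC_complex_def)
    then have "cspan (insert (coord 1 0 0) A) \<subseteq> {v. snd v = 0}"
      by (intro complex_vector.span_minimal) (auto simp: A_def coord_def)
    moreover assume "coord 0 0 1 \<in> cspan (insert (coord 1 0 0) A)"
    ultimately show False
      by (auto simp: coord_def)
  qed
  then show "\<not> cdependent B"
    unfolding B_def using A by (intro complex_vector.independent_insertI)
  show "card B = (if a = 0 then 2 else 3)"
    using a by (simp add: B_def A_def coord_eq_iff)
qed

lemma form_perp_split_space:
  "form_perp e split_space = {coord 0 y 0 |y. cinner y e = 0 \<and> cinner y a = 0}"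
proof (intro set_eqI iffI)
  fix v assume v: "v \<in> form_perp e split_space"
  obtain x y z where p: "v = coord x y z" "cinner y e = 0" by (rule coord_cases)
  have "form_hat e v (coord 1 0 0) = 0" "form_hat e v (coord 0 0 1) = 0"
    "form_hat e v (coord 0 a 0) = 0"
    using v split_space_basis by (simp_all add: form_perp_def)
  then show "v \<in> {coord 0 y 0 |y. cinner y e = 0 \<and> cinner y a = 0}"
    using p(2) a by (auto simp: p(1) form_hat_coord)
next
  fix v assume "v \<in> {coord 0 y 0 |y. cinner y e = 0 \<and> cinner y a = 0}"
  then show "v \<in> form_perp e split_space"
    using a by (auto simp: form_perp_def split_space_def form_hat_coord cinner_simps)
qed

lemma nondegenerate_on_split_space: "nondegenerate_on e split_space"
  unfolding nondegenerate_on_def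
proof (intro ballI impI)
  fix v assume v: "v \<in> split_space" "\<forall>w\<in>split_space. form_hat e v w = 0"
  then have "v \<in> form_perp e split_space"
    by (simp add: form_perp_def)
  then obtain y where y: "v = coord 0 y 0" "cinner y e = 0" "cinner y a = 0"
    by (auto simp: form_perp_split_space)
  obtain x c z where xc: "v = coord x (c *C a) z"
    using v(1) by (auto simp: split_space_def)
  then have "y = c *C a"
    using y a by (simp add: coord_eq_iff cinner_simps)
  then have "cinner y y = 0"
    using y(3) by (metis cinner_scaleC_right mult_zero_right)
  then show "v = 0"
    by (simp add: y(1) coord_0 cinner_self_eq_0_iff)
qed

lemma direct_sum_split_space: "direct_sum_decomp split_space (form_perp e split_space)"
proof -
  have "0 \<in> split_space \<inter> form_perp e split_space"
    using csubspace_split_space csubspace_form_perp complex_vector.subspace_0 by blast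
  moreover have "v = 0" if "v \<in> split_space \<inter> form_perp e split_space" for v
    using that nondegenerate_on_split_space
    by (simp add: nondegenerate_on_def form_perp_def del: split_paired_All)
  moreover have "\<exists>k\<in>split_space. \<exists>m\<in>form_perp e split_space. v = k + m" for v
  proof -
    obtain x y z where p: "v = coord x y z" "cinner y e = 0" by (rule coord_cases)
    \<comment> \<open>The coefficient of the orthogonal projection onto \<open>a\<close>; for
      \<open>a = 0\<close> the division yields 0, which is also correct.\<close>
    define c where "c = cinner y a / cinner a a"
    have "cinner (y - c *C a) a = 0"
      by (cases "a = 0") (simp_all add: c_def cinner_simps cinner_self_eq_0_iff)
    then have "coord 0 (y - c *C a) 0 \<in> form_perp e split_space"
      using p(2) a by (auto simp: form_perp_split_space cinner_simps)
    moreover have "v = coord x (c *C a) z + coord 0 (y - c *C a) 0"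
      by (simp add: p(1) coord_add)
    ultimately show ?thesis
      using split_spaceI by blast
  qed
  ultimately show ?thesis
    unfolding direct_sum_decomp_def
    using csubspace_split_space csubspace_form_perp by blast
qed

section \<open>Parabolicity, splitting and minimal polynomial of a non-scalar translation\<close>

context
  assumes s0: "s \<noteq> 0"
begin

text \<open>If \<open>z \<noteq> 0\<close>, the last coordinate gives \<open>\<mu> = l\<close>; the
  middle one then forces \<open>a = 0\<close>, and the first one \<open>s = 0\<close>. Hence all
  eigenvectors have \<open>z = 0\<close>, where the form is the square of \<open>norm y\<close>, and
  the light-like ones are multiples of \<open>coord 1 0 0\<close>. Parabolicity is read off from
  this.\<close>

lemma heisenberg_eigenvector_snd:
  assumes "heisenberg e l a s (coord x y z) = \<mu> *C coord x y z" "cinner y e = 0"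
  shows "z = 0"
proof (rule ccontr)
  assume z: "z \<noteq> 0"
  then have "\<mu> = l"
    using assms a by (simp add: heisenberg_coord coord_scaleC coord_eq_iff cinner_simps)
  then have "coord (l * (cinner y a + s * z)) ((l * z) *C a) 0 = 0"
    using assms heisenberg_nilpotent_part [of y x z] by simp
  moreover have "cinner ((l * z) *C a) e = 0"
    using a by (simp add: cinner_simps)
  ultimately have *: "l * (cinner y a + s * z) = 0" "(l * z) *C a = 0"
    using coord_eq_0_iff by blast+
  have "a = 0"
    using *(2) z l_cnj(3) by simp
  then show False
    using *(1) z s0 l_cnj(3) by simp
qed

lemma parabolic_heisenberg: "parabolic_hat e (heisenberg e l a s)"
  unfolding parabolic_hat_iff [OF heisenberg_in_G_hat]
proof (intro conjI allI impI exI)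
  fix v assume "eigenvector (heisenberg e l a s) v"
  then obtain \<mu> where \<mu>: "heisenberg e l a s v = \<mu> *C v"
    by (auto simp: eigenvector_def)
  obtain x y z where p: "v = coord x y z" "cinner y e = 0" by (rule coord_cases)
  have "z = 0"
    using heisenberg_eigenvector_snd \<mu> p by simp
  then show "0 \<le> Re (form_hat e v v)"
    using p(2) by (simp add: p(1) form_hat_coord Re_cinner_self)
next
  fix v assume v: "light_like e v \<and> eigenvector (heisenberg e l a s) v"
  then obtain \<mu> where \<mu>: "heisenberg e l a s v = \<mu> *C v"
    by (auto simp: eigenvector_def)
  obtain x y z where p: "v = coord x y z" "cinner y e = 0" by (rule coord_cases)
  have z: "z = 0"
    using heisenberg_eigenvector_snd \<mu> p by simp
  then have "y = 0"
    using v p(2) by (simp add: p(1) light_like_def form_hat_coord cinner_self_eq_0_iff)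
  then have "v = x *C coord 1 0 0"
    by (simp add: p(1) z coord_scaleC)
  then show "v \<in> cspan {coord 1 0 0}"
    unfolding complex_vector.span_singleton by blast
next
  show "light_like e (coord 1 0 0)"
    by (simp add: light_like_def coord_eq_0_iff form_hat_coord)
  show "eigenvector (heisenberg e l a s) (coord 1 0 0)"
    unfolding eigenvector_def using coord_unit_eigen by (auto simp: coord_eq_0_iff)
qed

lemma splitting_heisenberg: "splitting e l (heisenberg e l a s) split_space (coord 1 0 0)"
  unfolding splitting_def
proof (intro conjI ballI)
  show "light_like e (coord 1 0 0)"
    by (simp add: light_like_def coord_eq_0_iff form_hat_coord)
  show "eigenvector (heisenberg e l a s) (coord 1 0 0)"
    unfolding eigenvector_def using coord_unit_eigen by (auto simp: coord_eq_0_iff)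
  show "heisenberg e l a s ` split_space \<subseteq> split_space"
    using a
    by (auto simp: split_space_def heisenberg_coord cinner_simps scaleC_add_left [symmetric]) blast
  show perp: "heisenberg e l a s v = l *C v" if "v \<in> form_perp e split_space" for v
    using that by (auto simp: form_perp_split_space heisenberg_coord coord_scaleC)
  show "heisenberg e l a s ` form_perp e split_space \<subseteq> form_perp e split_space"
    using perp complex_vector.subspace_scale [OF csubspace_form_perp] by auto
  show "{v \<in> split_space. heisenberg e l a s v = l *C v} = cspan {coord 1 0 0}"
  proof (intro set_eqI iffI)
    fix v assume v: "v \<in> {v \<in> split_space. heisenberg e l a s v = l *C v}"
    then obtain x c z where xc: "v = coord x (c *C a) z"
      by (auto simp: split_space_def)
    have ca: "cinner (c *C a) e = 0"
      using a by (simp add: cinner_simps)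
    have z: "z = 0"
      using heisenberg_eigenvector_snd ca v xc by blast
    then have "coord (l * (cinner (c *C a) a + s * z)) ((l * z) *C a) 0 = 0"
      using v heisenberg_nilpotent_part [OF ca, of x z] by (simp add: xc)
    then have "cinner (c *C a) a = 0"
      using z l_cnj(3) by (simp add: coord_eq_0_iff)
    then have ca0: "c *C a = 0"
      by (metis cinner_scaleC_right cinner_self_eq_0_iff mult_zero_right)
    have "v = x *C coord 1 0 0"
      unfolding xc z ca0 coord_scaleC by simp
    then show "v \<in> cspan {coord 1 0 0}"
      unfolding complex_vector.span_singleton by blast
  next
    fix v assume "v \<in> cspan {coord 1 0 0}"
    then obtain c where "v = c *C coord 1 0 0"
      unfolding complex_vector.span_singleton by blast
    then show "v \<in> {v \<in> split_space. heisenberg e l a s v = l *C v}"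
      using coord_unit_eigen complex_vector.subspace_scale [OF csubspace_split_space split_space_basis(1)]
      by (simp add: bounded_clinear_scaleC_apply [OF bounded_clinear_heisenberg] mult.commute)
  qed
qed (simp_all add: csubspace_split_space cdim_split_space nondegenerate_on_split_space
    split_space_basis direct_sum_split_space)

text \<open>The single vector \<open>coord 0 0 1\<close> shows that the exponent is sharp: one
  application of the nilpotent part gives first coordinate \<open>l * s\<close>, two give
  \<open>l^2 * cinner a a\<close>.\<close>

lemma is_min_poly_on_heisenberg:
  assumes "splitting e l (heisenberg e l a s) K u"
  shows "is_min_poly_on (heisenberg e l a s) K ([:- l, 1:] ^ (if a = 0 then 2 else 3))"
proof (cases "a = 0")
  case True
  have "((\<lambda>v. heisenberg e l a s v - l *C v) ^^ Suc (Suc 0)) v = 0" for v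
  proof -
    obtain x y z where p: "v = coord x y z" "cinner y e = 0" by (rule coord_cases)
    show ?thesis
      using heisenberg_nilpotent_part_2 [OF p(2), of x z]
      by (simp only: p(1) numeral_2_eq_2) (simp add: True coord_0)
  qed
  moreover have "((\<lambda>v. heisenberg e l a s v - l *C v) ^^ Suc 0) (coord 0 0 1) \<noteq> 0"
    using s0 l_cnj(3) by (simp add: heisenberg_nilpotent_part coord_eq_0_iff a cinner_simps)
  ultimately have "is_min_poly_on (heisenberg e l a s) K ([:- l, 1:] ^ Suc (Suc 0))"
    by (rule is_min_poly_on_splitting [OF heisenberg_in_G_hat assms])
  then show ?thesis
    by (simp only: True numeral_2_eq_2 if_True simp_thms)
next
  case False
  have "((\<lambda>v. heisenberg e l a s v - l *C v) ^^ Suc (Suc 1)) v = 0" for v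
    using heisenberg_nilpotent_part_3 [of v] by (simp only: numeral_3_eq_3 One_nat_def)
  moreover have "((\<lambda>v. heisenberg e l a s v - l *C v) ^^ Suc 1) (coord 0 0 1) \<noteq> 0"
    using False l_cnj(3) heisenberg_nilpotent_part_2 [of 0 0 1]
    by (simp only: numeral_2_eq_2 One_nat_def) (simp add: coord_eq_0_iff cinner_self_eq_0_iff)
  ultimately have "is_min_poly_on (heisenberg e l a s) K ([:- l, 1:] ^ Suc (Suc 1))"
    by (rule is_min_poly_on_splitting [OF heisenberg_in_G_hat assms])
  then show ?thesis
    using False by (simp only: numeral_3_eq_3 One_nat_def if_False)
qed

lemma heisenberg_in_parabolic_of_degree_iff:
  "heisenberg e l a s \<in> parabolic_of_degree e l d \<longleftrightarrow> d = (if a = 0 then 2 else 3)"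
proof
  assume "heisenberg e l a s \<in> parabolic_of_degree e l d"
  then obtain K u p where "splitting e l (heisenberg e l a s) K u"
      "is_min_poly_on (heisenberg e l a s) K p" "degree p = d"
    by (auto simp: parabolic_of_degree_def)
  then have "d = degree ([:- l, 1:] ^ (if a = 0 then 2 else 3))"
    using is_min_poly_on_degree_unique is_min_poly_on_heisenberg by blast
  then show "d = (if a = 0 then 2 else 3)"
    by (simp only: degree_linear_power)
next
  assume d: "d = (if a = 0 then 2 else 3)"
  have "degree ([:- l, 1:] ^ d) = d"
    by (simp only: degree_linear_power)
  then show "heisenberg e l a s \<in> parabolic_of_degree e l d"
    unfolding parabolic_of_degree_def
    using heisenberg_in_G_hat parabolic_heisenberg op_spectrum_heisenberg splitting_heisenberg
      is_min_poly_on_heisenberg [OF splitting_heisenberg, folded d] by blast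
qed

end

end

subsection \<open>Reduction to a Heisenberg translation\<close>

text \<open>Seen through \<open>D\<close>, a light-like vector is a multiple of
  \<open>(x, 1)\<close> with \<open>norm x = 1\<close>, and a unitary of the first factor moves
  \<open>x\<close> into the line of \<open>e\<close>.\<close>

lemma light_like_to_coord:
  assumes "light_like e u"
  obtains g k where "g \<in> G_hat e" "k \<noteq> 0" "g u = k *C coord 1 0 0"
proof -
  have D_inv: "D e (inv (D e) p) = p" "inv (D e) (D e p) = p" for p
    using bij_D [OF norm_e] by (simp_all add: bij_is_surj surj_f_inv_f bij_is_inj)
  obtain y w where yw: "D e u = (y, w)" by fastforce
  have "form_A (D e u) (D e u) = 0"
    using assms by (simp add: form_A_D norm_e light_like_def)
  then have "complex_of_real ((norm y)\<^sup>2) = complex_of_real ((cmod w)\<^sup>2)"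
    by (simp only: yw form_A_def cinner_self fst_conv snd_conv complex_norm_square) simp
  then have "(norm y)\<^sup>2 = (cmod w)\<^sup>2"
    by (simp only: of_real_eq_iff)
  then have ny: "norm y = cmod w"
    by simp
  have w: "w \<noteq> 0"
  proof
    assume "w = 0"
    then have "D e u = 0" using ny by (simp add: yw zero_prod_def)
    then have "u = 0"
      by (metis D_inv(2) bounded_clinear_D(2) bounded_clinear_zero_apply norm_e)
    then show False using assms by (simp add: light_like_def)
  qed
  define x where "x = (1 / w) *C y"
  have "norm x = 1"
    using w ny by (simp add: x_def norm_scaleC norm_divide)
  then obtain c W where W: "cmod c = 1" "bounded_clinear W" "W \<circ> W = id" "W x = c *C e"
    "\<And>v w. cinner (W v) (W w) = cinner v w"
    using unitary_between_unit_vectors [OF _ norm_e] by metis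
  have cc: "c * cnj c = 1" "cnj c * c = 1"
    using W(1) by (simp_all add: complex_norm_square [symmetric] mult.commute)
  have WW: "W (W v) = v" for v
    using W(3) by (metis comp_apply id_apply)
  \<comment> \<open>The phase on the last coordinate matches the one in \<open>W x = c *C e\<close>,
    so that \<open>(x, 1)\<close> goes to \<open>c *C (e, 1)\<close>.\<close>
  define h where "h p = (W (fst p), c * snd p)" for p
  have h: "h \<in> G"
  proof -
    have "bounded_clinear h"
      unfolding h_def [abs_def]
      using bounded_clinear_comp [OF W(2) bounded_clinear_fst]
      by (intro bounded_clinear_intros) (simp add: comp_def)
    moreover have "bij h"
    proof (rule o_bij [where g = "\<lambda>p. (W (fst p), cnj c * snd p)"])
      show "(\<lambda>p. (W (fst p), cnj c * snd p)) \<circ> h = id" "h \<circ> (\<lambda>p. (W (fst p), cnj c * snd p)) = id"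
        by (simp_all add: fun_eq_iff h_def WW mult.assoc [symmetric] cc)
    qed
    moreover have "form_A (h p) (h q) = form_A p q" for p q
    proof -
      have "c * snd p * cnj (c * snd q) = (c * cnj c) * (snd p * cnj (snd q))"
        by simp
      then show ?thesis
        by (simp add: form_A_def h_def W(5) cc)
    qed
    ultimately show ?thesis
      by (simp add: isometry_group_def)
  qed
  define g where "g = inv (D e) \<circ> h \<circ> D e"
  have g: "g \<in> G_hat e"
    unfolding G_hat_eq [OF norm_e] g_def using h by blast
  have ee: "D e (coord 1 0 0) = complex_of_real (1 / sqrt 2) *C (e, 1)"
    using norm_e
    by (simp add: coord_def D_def perp_part_def cinner_simps cinner_self scaleC_one zero_prod_def
        [symmetric])
  \<comment> \<open>The \<open>sqrt 2\<close> undoes the factor \<open>1 / sqrt 2\<close> with which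
    \<open>D e\<close> sends \<open>coord 1 0 0\<close> to a multiple of
    \<open>(e, 1)\<close>.\<close>
  define k where "k = w * c * complex_of_real (sqrt 2)"
  have k: "k * complex_of_real (1 / sqrt 2) = w * c"
    by (simp add: k_def)
  have y: "y = w *C x"
    using w by (simp add: x_def scaleC_simps)
  have "h (D e u) = (w * c) *C (e, 1)"
    unfolding yw h_def y
    by (simp add: bounded_clinear_scaleC_apply [OF W(2)] W(4) scaleC_prod_def scaleC_complex_def
        scaleC_scaleC mult.commute)
  also have "\<dots> = D e (k *C coord 1 0 0)"
    by (simp only: D_scaleC ee scaleC_scaleC k)
  finally have "g u = k *C coord 1 0 0"
    by (simp add: g_def D_inv)
  moreover have "k \<noteq> 0"
    using w cc by (auto simp: k_def)
  ultimately show thesis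
    using g that by blast
qed

lemma perp_part_linear:
  "perp_part e (x + y) = perp_part e x + perp_part e y"
  "perp_part e (c *C x) = c *C perp_part e x"
  by (simp_all add: perp_part_def cinner_simps scaleC_simps scaleC_left_simps)

text \<open>Pairing with the eigenvector reads off the last coordinate up to sign, so
  \<open>S\<close> is triangular with lower corner \<open>1 / cnj l\<close>; the spectrum identifies
  this with \<open>l\<close>. Once the middle block is scalar, the image of
  \<open>coord 0 0 1\<close> determines everything else: it must be light-like and orthogonal to the
  images of the middle vectors.\<close>

lemma heisenberg_of_triangular:
  assumes S: "S \<in> G_hat e" and Se: "S (coord 1 0 0) = l *C coord 1 0 0"
    and spec: "op_spectrum S = {l}"
  obtains a s where "cmod l = 1" "cinner a e = 0" "Re s = (norm a)\<^sup>2 / 2" "S = heisenberg e l a s"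
proof -
  note S_simps = bounded_clinear_simps [OF G_hatD(1) [OF S]]
  have form_e: "form_hat e p (coord 1 0 0) = - snd p" for p
    by (rule coord_cases [of p]) (simp add: form_hat_coord, simp add: coord_def)
  have snd_S: "snd p = cnj l * snd (S p)" for p
    using G_hatD(3) [OF S, of p "coord 1 0 0"] unfolding Se
    by (simp add: form_hat_linear form_e)
  have l0: "l \<noteq> 0"
    using snd_S [of "coord 0 0 1"] by (auto simp: coord_def)
  have resolvent: "\<exists>Q. bounded_clinear Q \<and> (\<forall>v. Q (S v - \<mu> *C v) = v) \<and> (\<forall>v. S (Q v) - \<mu> *C Q v = v)"
    if "\<mu> \<noteq> l" for \<mu>
  proof -
    have "\<mu> \<notin> op_spectrum S"
      using that spec by simp
    then show ?thesis
      unfolding op_spectrum_def fun_eq_iff comp_def id_def by blast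
  qed
  \<comment> \<open>Otherwise \<open>S - 1 / cnj l\<close> would be invertible, although all its
    values have last coordinate 0.\<close>
  have l1: "cnj l * l = 1"
  proof (rule ccontr)
    assume l1: "cnj l * l \<noteq> 1"
    then have "1 / cnj l \<noteq> l"
      using l0 by (simp add: field_simps)
    then obtain Q where "\<And>v. S (Q v) - (1 / cnj l) *C Q v = v"
      using resolvent by blast
    then have "snd (S (Q (coord 0 0 1)) - (1 / cnj l) *C Q (coord 0 0 1)) = 1"
      by (simp add: coord_def)
    then show False
      using l0 snd_S [of "Q (coord 0 0 1)"] by (simp add: scaleC_prod_def scaleC_complex_def)
  qed
  then have l1': "l * cnj l = 1"
    by (simp add: mult.commute)
  have "(cmod l)\<^sup>2 = 1"
    using l1' by (metis complex_norm_square of_real_eq_1_iff)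
  then have norm_l: "cmod l = 1"
    using power2_eq_iff_nonneg [of "cmod l" 1] by simp
  have snd_S': "snd (S p) = l * snd p" for p
    using snd_S [of p] l1' by (simp add: mult.assoc [symmetric])
  have below: "\<exists>c>0. \<forall>p. c * norm p \<le> norm (S p - \<mu> *C p)" if \<mu>: "\<mu> \<noteq> l" for \<mu>
  proof -
    obtain Q where Q: "bounded_clinear Q" "\<And>v. Q (S v - \<mu> *C v) = v"
      using resolvent [OF \<mu>] by blast
    obtain K where K: "K > 0" "\<And>p. norm (Q p) \<le> norm p * K"
      using Q(1) bounded_linear.pos_bounded unfolding bounded_clinear_def by blast
    have "1 / K * norm p \<le> norm (S p - \<mu> *C p)" for p
      using K(2) [of "S p - \<mu> *C p"] K(1) by (simp add: Q(2) field_simps)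
    then show ?thesis
      using K(1) by (intro exI [of _ "1 / K"]) auto
  qed
  define \<beta> U where "\<beta> y = cinner (fst (S (coord 0 y 0))) e"
    and "U y = perp_part e (fst (S (coord 0 y 0)))" for y
  have Ue: "cinner (U y) e = 0" for y
    by (simp add: U_def cinner_perp_part norm_e)
  have SU: "S (coord 0 y 0) = coord (\<beta> y) (U y) 0" for y
  proof -
    have "snd (S (coord 0 y 0)) = 0"
      by (simp add: snd_S') (simp add: coord_def)
    then show ?thesis
      by (simp add: prod_eq_iff coord_def \<beta>_def U_def perp_part_def)
  qed
  have S_coord: "S (coord x y 0) = coord (x * l + \<beta> y) (U y) 0" for x y
  proof -
    have "S (coord x y 0) = S (x *C coord 1 0 0 + coord 0 y 0)"
      by (simp add: coord_scaleC coord_add)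
    also have "\<dots> = coord (x * l + \<beta> y) (U y) 0"
      by (simp only: S_simps Se SU) (simp add: coord_scaleC coord_add)
    finally show ?thesis .
  qed
  have U_linear: "U (x + y) = U x + U y" "U (c *C x) = c *C U x" for x y c
  proof -
    have "coord 0 (x + y) 0 = coord 0 x 0 + coord 0 y 0" "coord 0 (c *C x) 0 = c *C coord 0 x 0"
      by (simp_all add: coord_add coord_scaleC)
    then show "U (x + y) = U x + U y" "U (c *C x) = c *C U x"
      by (simp_all only: U_def S_simps fst_add perp_part_linear) (simp add: scaleC_prod_def perp_part_linear)
  qed
  have U_iso: "cinner (U x) (U y) = cinner x y" if "cinner x e = 0" "cinner y e = 0" for x y
    using G_hatD(3) [OF S, of "coord 0 x 0" "coord 0 y 0"] that by (simp add: SU form_hat_coord Ue)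
  \<comment> \<open>Extending the block by \<open>l\<close> along \<open>e\<close> gives an operator
    on the whole type, to which the scalar criterion applies.\<close>
  define V where "V x = (l * cinner x e) *C e + U (perp_part e x)" for x
  have perp_e: "cinner (perp_part e x) e = 0" for x
    by (simp add: cinner_perp_part norm_e)
  have V: "cinner (V x) e = l * cinner x e" "perp_part e (V x) = U (perp_part e x)" for x
    using coord_components [OF Ue, of "l * cinner x e" "perp_part e x" 0]
    by (simp_all add: V_def coord_def)
  have V_scalar: "V x = l *C x" for x
  proof (rule unitary_scalar_of_bounded_below [OF _ _ _ _ norm_l])
    show "V (x + y) = V x + V y" for x y
      by (simp add: V_def cinner_simps perp_part_linear U_linear distrib_left scaleC_add_left)
    show "V (c *C x) = c *C V x" for c x
      by (simp add: V_def cinner_simps perp_part_linear U_linear scaleC_simps mult.left_commute)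
    show "cinner (V x) (V y) = cinner x y" for x y
    proof -
      have "cinner (V x) (V y) = (l * cnj l) * (cinner x e * cnj (cinner y e))
          + cinner (perp_part e x) (perp_part e y)"
        by (simp add: cinner_decomp [OF norm_e, of "V x" "V y"] V U_iso perp_e)
      then show ?thesis
        unfolding l1' cinner_decomp [OF norm_e, of x y] by simp
    qed
    show "surj V"
      unfolding surj_def
    proof
      fix w
      \<comment> \<open>Surjectivity of the block comes from that of \<open>S\<close>: a preimage of
        a vector with last coordinate 0 again has last coordinate 0, and its middle coordinate is
        the one wanted.\<close>
      define p where "p = inv S (coord 0 (perp_part e w) 0)"
      have Sp: "S p = coord 0 (perp_part e w) 0"
        by (simp add: p_def G_hat_inv_apply [OF S])
      obtain x y z where p: "p = coord x y z" "cinner y e = 0" by (rule coord_cases)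
      have "z = 0"
        using snd_S [of p] by (simp add: Sp) (simp add: p coord_def)
      then have "U y = perp_part e w"
        using Sp by (simp add: p(1) S_coord coord_eq_iff Ue perp_e)
      moreover have "perp_part e ((cinner w e / l) *C e + y) = y"
        "cinner ((cinner w e / l) *C e + y) e = cinner w e / l"
        using coord_components [OF p(2), of "cinner w e / l" 0] by (simp_all add: coord_def)
      ultimately have "V ((cinner w e / l) *C e + y) = w"
        using l0 by (simp add: V_def perp_part_def)
      then show "\<exists>x. w = V x" by metis
    qed
    fix \<mu> assume \<mu>: "\<mu> \<noteq> l"
    then obtain c where c: "c > 0" "\<And>p. c * norm p \<le> norm (S p - \<mu> *C p)"
      using below by blast
    \<comment> \<open>The lower bound is \<open>c\<close> on the complement of \<open>e\<close> and
      \<open>cmod (l - \<mu>)\<close> along \<open>e\<close>; the two summands are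
      orthogonal.\<close>
    define d where "d = min c (cmod (l - \<mu>))"
    have d: "0 < d" "d \<le> c" "d \<le> cmod (l - \<mu>)"
      using c \<mu> by (simp_all add: d_def)
    have "d * norm x \<le> norm (V x - \<mu> *C x)" for x
    proof -
      define y where "y = perp_part e x"
      \<comment> \<open>The \<open>e\<close>-coordinate \<open>t\<close> cancels the off-diagonal
        term \<open>\<beta> y\<close>, so that the lower bound for \<open>S - \<mu>\<close> becomes
        one for \<open>U - \<mu>\<close>.\<close>
      define t where "t = - \<beta> y / (l - \<mu>)"
      have y: "cinner y e = 0" "cinner (U y - \<mu> *C y) e = 0"
        by (simp_all add: y_def perp_e Ue cinner_simps)
      have "S (coord t y 0) - \<mu> *C coord t y 0 = coord (t * (l - \<mu>) + \<beta> y) (U y - \<mu> *C y) 0"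
        by (simp add: S_coord coord_scaleC coord_diff algebra_simps)
      also have "\<dots> = coord 0 (U y - \<mu> *C y) 0"
        using \<mu> by (simp add: t_def)
      finally have "c * norm (coord t y 0) \<le> norm (coord 0 (U y - \<mu> *C y) 0)"
        using c(2) by metis
      moreover have "norm y \<le> norm (coord t y 0)"
        by (rule power2_le_imp_le) (simp_all add: norm_coord [OF y(1)])
      moreover have "norm (coord 0 (U y - \<mu> *C y) 0) = norm (U y - \<mu> *C y)"
        using norm_coord [OF y(2), of 0 0] by simp
      ultimately have "d * norm y \<le> norm (U y - \<mu> *C y)"
        using mult_mono [OF d(2), of "norm y" "norm (coord t y 0)"] c(1) by simp
      then have 1: "d\<^sup>2 * (norm y)\<^sup>2 \<le> (norm (U y - \<mu> *C y))\<^sup>2"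
        using d by (simp add: power_mult_distrib [symmetric] power_mono)
      have 2: "d\<^sup>2 * (cmod (cinner x e))\<^sup>2 \<le> (cmod ((l - \<mu>) * cinner x e))\<^sup>2"
        using d by (simp add: norm_mult power_mult_distrib power_mono mult_right_mono)
      have x: "coord (cinner x e) y 0 = (x, 0)"
        by (simp add: coord_def y_def perp_part_def)
      have Vx: "coord ((l - \<mu>) * cinner x e) (U y - \<mu> *C y) 0 = (V x - \<mu> *C x, 0)"
      proof -
        have "V x - \<mu> *C x = V x - \<mu> *C (cinner x e *C e + y)"
          by (simp add: y_def perp_part_def)
        then show ?thesis
          by (simp add: coord_def V_def y_def scaleC_left_simps scaleC_add_right left_diff_distrib)
      qed
      have "(d * norm x)\<^sup>2 \<le> (norm (V x - \<mu> *C x))\<^sup>2"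
        using norm_coord [OF y(1), of "cinner x e" 0] 1 2
          norm_coord [OF y(2), of "(l - \<mu>) * cinner x e" 0]
        unfolding x Vx by (simp add: norm_prod_def power_mult_distrib distrib_left)
      then show ?thesis
        by (rule power2_le_imp_le) simp
    qed
    then show "\<exists>c>0. \<forall>x. c * norm x \<le> norm (V x - \<mu> *C x)"
      using d(1) by blast
  qed
  have U: "U y = l *C y" if "cinner y e = 0" for y
    using V(2) [of y] that by (simp add: V_scalar perp_part_def cinner_simps)
  obtain t b w where tb: "S (coord 0 0 1) = coord t b w" "cinner b e = 0" by (rule coord_cases)
  have w: "w = l"
    using snd_S' [of "coord 0 0 1"] by (simp add: tb(1)) (simp add: coord_def)
  define a s where "a = cnj l *C b" and "s = cnj l * t"
  have bt: "b = l *C a" "t = l * s"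
    by (simp_all add: a_def s_def scaleC_simps mult.assoc [symmetric] l1')
  have a: "cinner a e = 0"
    by (simp add: a_def cinner_simps tb(2))
  have "form_hat e (coord t b w) (coord t b w) = 0"
    using G_hatD(3) [OF S, of "coord 0 0 1" "coord 0 0 1"] by (simp add: tb(1) form_hat_coord)
  then have "(l * cnj l) * (cinner a a - cnj s - s) = 0"
    using tb(2) by (simp add: form_hat_coord w bt cinner_simps algebra_simps)
  then have "cinner a a = s + cnj s"
    by (simp add: l1' algebra_simps)
  then have s: "Re s = (norm a)\<^sup>2 / 2"
    by (simp add: cinner_self complex_eq_iff)
  \<comment> \<open>The images of \<open>coord 0 y 0\<close> and \<open>coord 0 0 1\<close> stay
    orthogonal for the form, which ties the first row of \<open>S\<close> to its last
    column.\<close>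
  have \<beta>: "\<beta> y = l * cinner y a" if "cinner y e = 0" for y
  proof -
    have "form_hat e (coord (\<beta> y) (U y) 0) (coord t b w) = 0"
      using G_hatD(3) [OF S, of "coord 0 y 0" "coord 0 0 1"] that by (simp add: tb SU form_hat_coord)
    then show ?thesis
      using tb(2) that l0 by (auto simp: form_hat_coord Ue U w bt cinner_simps algebra_simps)
  qed
  have "S p = heisenberg e l a s p" for p
  proof -
    obtain x y z where p: "p = coord x y z" "cinner y e = 0" by (rule coord_cases)
    have "p = coord x y 0 + z *C coord 0 0 1"
      by (simp add: p coord_scaleC coord_add)
    then have "S p = coord (x * l + \<beta> y) (U y) 0 + z *C coord t b w"
      by (simp only: S_simps S_coord tb)
    also have "\<dots> = heisenberg e l a s p"
      using p(2) by (simp add: p(1) heisenberg_coord U \<beta> w bt coord_scaleC coord_add scaleC_simps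
          algebra_simps)
    finally show ?thesis .
  qed
  then have "S = heisenberg e l a s" by (rule ext)
  then show thesis
    using that norm_l a s by blast
qed

lemma parabolic_conj_heisenberg:
  assumes S: "S \<in> G_hat e" and par: "parabolic_hat e S" and spec: "op_spectrum S = {l}"
  obtains a s where "cmod l = 1" "cinner a e = 0" "Re s = (norm a)\<^sup>2 / 2" "s \<noteq> 0"
    "heisenberg e l a s \<in> conj_class (G_hat e) S"
proof -
  obtain u where u: "light_like e u" "eigenvector S u"
    using par unfolding parabolic_hat_iff [OF S] by blast
  then obtain \<mu> where \<mu>: "S u = \<mu> *C u" "u \<noteq> 0"
    by (auto simp: eigenvector_def)
  have "\<mu> \<in> op_spectrum S"
  proof (rule ccontr)
    assume "\<mu> \<notin> op_spectrum S"
    then obtain Q where "bounded_clinear Q" "\<And>v. Q (S v - \<mu> *C v) = v"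
      unfolding op_spectrum_def fun_eq_iff comp_def id_def by blast
    then show False
      using \<mu> by (metis bounded_clinear_zero_apply diff_self)
  qed
  then have \<mu>l: "S u = l *C u"
    using \<mu> spec by simp
  obtain g k where g: "g \<in> G_hat e" "k \<noteq> 0" "g u = k *C coord 1 0 0"
    using light_like_to_coord [OF u(1)] .
  define R where "R = g \<circ> S \<circ> inv g"
  have gR: "g (S p) = R (g p)" for p
    by (simp add: R_def G_hat_inv_apply [OF g(1)])
  have R: "R \<in> G_hat e"
    using S g(1) gR by (rule conj_in_G_hat)
  have "R (k *C coord 1 0 0) = l *C k *C coord 1 0 0"
    using conj_eigen_iff [OF S g(1) gR, of u l] \<mu>l by (simp only: g(3))
  then have "k *C R (coord 1 0 0) = k *C l *C coord 1 0 0"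
    by (simp only: bounded_clinear_scaleC_apply [OF G_hatD(1) [OF R]] scaleC_scaleC mult.commute)
  then have "R (coord 1 0 0) = l *C coord 1 0 0"
    using g(2) by (simp only: complex_vector.scale_cancel_left) blast
  then obtain a s where as: "cmod l = 1" "cinner a e = 0" "Re s = (norm a)\<^sup>2 / 2"
      "R = heisenberg e l a s"
    using heisenberg_of_triangular [OF R] conj_op_spectrum [OF S g(1) gR] spec by metis
  \<comment> \<open>With \<open>s = 0\<close> also \<open>a = 0\<close>, and \<open>R\<close> would
    be scalar; then \<open>coord 1 0 1\<close>, on which the form is \<open>-2\<close>, would be a
    negative eigenvector.\<close>
  have "s \<noteq> 0"
  proof
    assume s: "s = 0"
    then have "R (coord 1 0 1) = l *C coord 1 0 1"
      using as by (simp add: heisenberg_coord coord_scaleC)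
    then have "eigenvector R (coord 1 0 1)"
      unfolding eigenvector_def by (auto simp: coord_eq_0_iff)
    moreover have "parabolic_hat e R"
      using conj_parabolic_hat [OF S g(1) gR par] .
    ultimately have "0 \<le> Re (form_hat e (coord 1 0 1) (coord 1 0 1))"
      unfolding parabolic_hat_iff [OF R] by blast
    then show False
      by (simp add: form_hat_coord)
  qed
  moreover have "heisenberg e l a s \<in> conj_class (G_hat e) S"
    unfolding as(4) [symmetric] conj_class_iff using g(1) gR by blast
  ultimately show thesis
    using that as by blast
qed

subsection \<open>Normal forms of Heisenberg translations\<close>

text \<open>The conjugator is diagonal with entries \<open>r\<close>, 1, \<open>1 / cnj r\<close>. A
  complex \<open>r\<close> can change the phase of \<open>a\<close> as well as its length, whereas
  \<open>s\<close> only meets the positive number \<open>r * cnj r\<close>.\<close>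

lemma heisenberg_conj_dilation:
  assumes r: "r \<noteq> 0" and a: "cinner a e = 0"
  shows "heisenberg e l (cnj r *C a) (r * cnj r * s) \<in> conj_class (G_hat e) (heisenberg e l a s)"
proof -
  define dil where "dil r p = coord (r * cinner (fst p) e) (perp_part e (fst p)) (1 / cnj r * snd p)" for r p
  have dil: "dil r (coord x y z) = coord (r * x) y (z / cnj r)" if "cinner y e = 0" for r x y z
    using that by (simp add: dil_def coord_components)
  have "dil r \<in> G_hat e"
  proof (rule G_hatI [where R = "dil (1 / r)"])
    show "bounded_clinear (dil r)"
      unfolding dil_def [abs_def] coord_def perp_part_def
      by (intro bounded_clinear_intros)
    fix p q
    obtain x y z where p: "p = coord x y z" "cinner y e = 0" by (rule coord_cases)
    obtain x' y' z' where q: "q = coord x' y' z'" "cinner y' e = 0" by (rule coord_cases)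
    show "dil r (dil (1 / r) p) = p" "dil (1 / r) (dil r p) = p"
      using r p(2) by (simp_all add: p(1) dil)
    show "form_hat e (dil r p) (dil r q) = form_hat e p q"
      using r p(2) q(2) by (simp add: p(1) q(1) dil form_hat_coord)
  qed
  moreover have "dil r (heisenberg e l a s p) = heisenberg e l (cnj r *C a) (r * cnj r * s) (dil r p)" for p
  proof -
    obtain x y z where p: "p = coord x y z" "cinner y e = 0" by (rule coord_cases)
    show ?thesis
      using r p(2) a
      by (simp add: p(1) dil heisenberg_coord cinner_simps) (simp add: algebra_simps)
  qed
  ultimately show ?thesis
    unfolding conj_class_iff by blast
qed

text \<open>Composing with the translation along \<open>b\<close> on either side differs only in the
  term \<open>cinner a b\<close> against \<open>cinner b a\<close>; the change of \<open>s\<close>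
  compensates for this.\<close>

lemma heisenberg_conj_translation:
  assumes a: "cinner a e = 0" and b: "cinner b e = 0"
  shows "heisenberg e l a (s + cinner a b - cinner b a) \<in> conj_class (G_hat e) (heisenberg e l a s)"
proof -
  let ?t = "complex_of_real ((norm b)\<^sup>2 / 2)"
  have "heisenberg e 1 b ?t \<in> G_hat e"
    using b by (intro heisenberg_in_G_hat) simp_all
  moreover have "heisenberg e 1 b ?t (heisenberg e l a s p) =
      heisenberg e l a (s + cinner a b - cinner b a) (heisenberg e 1 b ?t p)" for p
    using a b by (simp add: heisenberg_compose add_ac)
  ultimately show ?thesis
    unfolding conj_class_iff by blast
qed

lemma heisenberg_conj_unitary:
  assumes W: "bounded_clinear W" "W \<circ> W = id" "\<And>v w. cinner (W v) (W w) = cinner v w" "W e = e"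
    and a: "cinner a e = 0"
  shows "heisenberg e l (W a) s \<in> conj_class (G_hat e) (heisenberg e l a s)"
proof -
  define h where "h p = (W (fst p), snd p)" for p :: "'a \<times> complex"
  have h: "h (coord x y z) = coord x (W y) z" for x y z
    by (simp add: h_def coord_def bounded_clinear_simps [OF W(1)] W(4))
  have We: "cinner (W y) e = cinner y e" for y
    by (metis W(3,4))
  have WW: "W (W y) = y" for y
    using W(2) by (metis comp_apply id_apply)
  have "h \<in> G_hat e"
  proof (rule G_hatI [where R = h])
    show "bounded_clinear h"
      unfolding h_def [abs_def]
      using bounded_clinear_comp [OF W(1) bounded_clinear_fst]
      by (intro bounded_clinear_intros) (simp add: comp_def)
    fix p q
    obtain x y z where p: "p = coord x y z" "cinner y e = 0" by (rule coord_cases)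
    obtain x' y' z' where q: "q = coord x' y' z'" "cinner y' e = 0" by (rule coord_cases)
    show "h (h p) = p" "h (h p) = p"
      by (simp_all add: p h WW)
    show "form_hat e (h p) (h q) = form_hat e p q"
      using p(2) q(2) by (simp add: p(1) q(1) h form_hat_coord We W(3))
  qed
  moreover have "h (heisenberg e l a s p) = heisenberg e l (W a) s (h p)" for p
  proof -
    obtain x y z where p: "p = coord x y z" "cinner y e = 0" by (rule coord_cases)
    show ?thesis
      using p(2) a
      by (simp add: p(1) h heisenberg_coord We W(3) bounded_clinear_simps [OF W(1)])
  qed
  ultimately show ?thesis
    unfolding conj_class_iff by blast
qed

lemma heisenberg_conj_of_imaginary:
  assumes "Re s = 0" "s \<noteq> 0"
  shows "heisenberg e l 0 s \<in> conj_class (G_hat e) (heisenberg e l 0 \<i>) \<or>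
    heisenberg e l 0 s \<in> conj_class (G_hat e) (heisenberg e l 0 (- \<i>))"
proof -
  define r where "r = complex_of_real (sqrt \<bar>Im s\<bar>)"
  have "Im s \<noteq> 0"
    using assms complex_eq_iff by auto
  then have "r \<noteq> 0" by (simp add: r_def)
  have rr: "r * cnj r = complex_of_real \<bar>Im s\<bar>"
    unfolding r_def complex_cnj_complex_of_real of_real_mult [symmetric] by simp
  have "s = r * cnj r * \<i> \<or> s = r * cnj r * (- \<i>)"
    unfolding rr using assms(1) by (auto simp: complex_eq_iff)
  then show ?thesis
    using heisenberg_conj_dilation [OF \<open>r \<noteq> 0\<close>, of 0 l \<i>]
      heisenberg_conj_dilation [OF \<open>r \<noteq> 0\<close>, of 0 l "- \<i>"]
    by auto
qed

text \<open>
  The vertical translations \<open>(l, 0, i)\<close> and \<open>(l, 0, -i)\<close> are told apart by the sign of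
  \<open>\<A>(T v - l v, v) / (l i)\<close>, which a conjugation in the isometry group preserves.
\<close>

lemma heisenberg_imaginary_disjoint:
  assumes "l \<noteq> 0"
  shows "conj_class (G_hat e) (heisenberg e l 0 \<i>) \<inter> conj_class (G_hat e) (heisenberg e l 0 (- \<i>)) = {}"
proof (rule ccontr)
  assume "conj_class (G_hat e) (heisenberg e l 0 \<i>) \<inter> conj_class (G_hat e) (heisenberg e l 0 (- \<i>)) \<noteq> {}"
  then have "heisenberg e l 0 (- \<i>) \<in> conj_class (G_hat e) (heisenberg e l 0 \<i>)"
    using conj_class_sym conj_class_trans by blast
  then obtain g where g: "g \<in> G_hat e"
      "\<And>p. g (heisenberg e l 0 \<i> p) = heisenberg e l 0 (- \<i>) (g p)"
    unfolding conj_class_iff by blast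
  have form: "form_hat e (heisenberg e l 0 s p - l *C p) p = - (l * s * complex_of_real ((cmod (snd p))\<^sup>2))"
    for s p
  proof -
    obtain x y z where p: "p = coord x y z" "cinner y e = 0" by (rule coord_cases)
    have "heisenberg e l 0 s p - l *C p = coord (l * s * z) 0 0"
      using p(2) by (simp add: p(1) heisenberg_coord coord_scaleC coord_diff algebra_simps)
    then show ?thesis
      using p(2) by (simp add: p(1) form_hat_coord coord_components mult.assoc complex_norm_square
          del: of_real_power)
  qed
  let ?p = "coord 0 0 1"
  have "heisenberg e l 0 (- \<i>) (g ?p) - l *C g ?p = g (heisenberg e l 0 \<i> ?p - l *C ?p)"
    by (simp only: g(2) bounded_clinear_simps [OF G_hatD(1) [OF g(1)]])
  then have "form_hat e (heisenberg e l 0 (- \<i>) (g ?p) - l *C g ?p) (g ?p) =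
      form_hat e (heisenberg e l 0 \<i> ?p - l *C ?p) ?p"
    by (simp only: G_hatD(3) [OF g(1)])
  then have "(l * \<i>) * complex_of_real ((cmod (snd (g ?p)))\<^sup>2) =
      (l * \<i>) * complex_of_real (- ((cmod (snd ?p))\<^sup>2))"
    unfolding form by simp
  moreover have "l * \<i> \<noteq> 0" using assms by simp
  ultimately have "complex_of_real ((cmod (snd (g ?p)))\<^sup>2) = complex_of_real (- ((cmod (snd ?p))\<^sup>2))"
    by (simp only: mult_cancel_left) blast
  then have "(cmod (snd (g ?p)))\<^sup>2 = - ((cmod (snd ?p))\<^sup>2)"
    by (simp only: of_real_eq_iff)
  then show False
    using zero_le_power2 [of "cmod (snd (g ?p))"] by (simp add: coord_components)
qed

text \<open>\<open>Re s\<close> is determined by \<open>norm a\<close>, so three moves suffice: a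
  reflection takes \<open>a\<close> into the line of \<open>a'\<close>, a dilation corrects length
  and phase, and a translation corrects \<open>Im s\<close>.\<close>

lemma heisenberg_conj_of_nonzero:
  assumes a: "a \<noteq> 0" "cinner a e = 0" "Re s = (norm a)\<^sup>2 / 2"
    and a': "a' \<noteq> 0" "cinner a' e = 0" "Re s' = (norm a')\<^sup>2 / 2"
  shows "heisenberg e l a' s' \<in> conj_class (G_hat e) (heisenberg e l a s)"
proof -
  define x y where "x = complex_of_real (1 / norm a) *C a" and "y = complex_of_real (1 / norm a') *C a'"
  have "norm x = 1" "norm y = 1"
    using a a' by (simp_all add: x_def y_def norm_scaleC norm_divide)
  then obtain c W where W: "cmod c = 1" "bounded_clinear W" "W \<circ> W = id" "W x = c *C y"
    "\<And>v w. cinner (W v) (W w) = cinner v w"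
    "\<And>v. cinner v x = 0 \<Longrightarrow> cinner v y = 0 \<Longrightarrow> W v = v"
    using unitary_between_unit_vectors by metis
  \<comment> \<open>\<open>e\<close> is orthogonal to both unit vectors, so the reflection fixes it
    and preserves its complement.\<close>
  have "cinner e a = 0" "cinner e a' = 0"
    using a a' cinner_perp_commute by blast+
  then have We: "W e = e"
    by (intro W(6)) (simp_all add: x_def y_def cinner_simps)
  define k where "k = complex_of_real (norm a) * c * complex_of_real (1 / norm a')"
  have "a = complex_of_real (norm a) *C x"
    using a(1) by (simp add: x_def scaleC_simps)
  then have "W a = complex_of_real (norm a) *C W x"
    by (metis bounded_clinear_scaleC_apply [OF W(2)])
  then have Wa: "W a = k *C a'"
    by (simp only: W(4) k_def y_def scaleC_scaleC mult.assoc)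
  have nk: "cmod k = norm a / norm a'"
    using W(1) by (simp add: k_def norm_mult norm_divide)
  then have k: "k \<noteq> 0"
    using a(1) a'(1) by auto
  define r where "r = 1 / cnj k"
  have r: "r \<noteq> 0" "cnj r * k = 1"
    using k by (simp_all add: r_def)
  define s1 where "s1 = r * cnj r * s"
  have "r * cnj r = complex_of_real ((norm a' / norm a)\<^sup>2)"
    unfolding complex_norm_square [symmetric] by (simp add: r_def norm_divide nk)
  then have s1: "Re s1 = (norm a')\<^sup>2 / 2"
    using a(1) by (simp add: s1_def a(3) power_divide)
  have ka': "cinner (k *C a') e = 0"
    using a' by (simp add: cinner_simps)
  have "heisenberg e l (k *C a') s \<in> conj_class (G_hat e) (heisenberg e l a s)"
    using heisenberg_conj_unitary [OF W(2,3,5) We a(2)] by (simp add: Wa)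
  moreover have "heisenberg e l a' s1 \<in> conj_class (G_hat e) (heisenberg e l (k *C a') s)"
    using heisenberg_conj_dilation [OF r(1) ka', of l s] by (simp add: r(2) s1_def scaleC_scaleC scaleC_one)
  moreover have "heisenberg e l a' s' \<in> conj_class (G_hat e) (heisenberg e l a' s1)"
  proof -
    \<comment> \<open>For \<open>b = \<tau> *C a'\<close> with imaginary \<open>\<tau>\<close>, the
      shift of \<open>s\<close> is \<open>- 2 * \<tau>\<close> times the square of
      \<open>norm a'\<close>; the constant is chosen so that this removes
      \<open>Im s1 - Im s'\<close>.\<close>
    define \<tau> where "\<tau> = \<i> * complex_of_real ((Im s1 - Im s') / (2 * (norm a')\<^sup>2))"
    have "cinner (\<tau> *C a') e = 0"
      using a' by (simp add: cinner_simps)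
    note conj = heisenberg_conj_translation [OF a'(2) this, of l s1]
    have "cinner a' (\<tau> *C a') - cinner (\<tau> *C a') a' = (cnj \<tau> - \<tau>) * complex_of_real ((norm a')\<^sup>2)"
      by (simp add: cinner_simps cinner_self left_diff_distrib)
    also have "cnj \<tau> - \<tau> = - (2 * \<i>) * complex_of_real ((Im s1 - Im s') / (2 * (norm a')\<^sup>2))"
      by (simp add: \<tau>_def)
    also have "\<dots> * complex_of_real ((norm a')\<^sup>2) = - \<i> * complex_of_real (Im s1 - Im s')"
      using a'(1) by simp
    finally have "s1 + cinner a' (\<tau> *C a') - cinner (\<tau> *C a') a' = s1 - \<i> * complex_of_real (Im s1 - Im s')"
      by (simp add: algebra_simps)
    also have "\<dots> = s'"
      by (simp add: complex_eq_iff s1 a'(3))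
    finally show ?thesis
      using conj by simp
  qed
  ultimately show ?thesis
    using conj_class_trans by blast
qed

lemma parabolic_of_degree_conj_heisenberg:
  assumes "S \<in> parabolic_of_degree e l d"
  obtains a s where "cmod l = 1" "cinner a e = 0" "Re s = (norm a)\<^sup>2 / 2" "s \<noteq> 0"
    "heisenberg e l a s \<in> conj_class (G_hat e) S" "d = (if a = 0 then 2 else 3)"
proof -
  have "S \<in> G_hat e" "parabolic_hat e S" "op_spectrum S = {l}"
    using assms by (auto simp: parabolic_of_degree_def)
  then obtain a s where as: "cmod l = 1" "cinner a e = 0" "Re s = (norm a)\<^sup>2 / 2" "s \<noteq> 0"
      "heisenberg e l a s \<in> conj_class (G_hat e) S"
    by (rule parabolic_conj_heisenberg)
  have "heisenberg e l a s \<in> parabolic_of_degree e l d"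
    using as(5) assms by (rule parabolic_of_degree_conj)
  then have "d = (if a = 0 then 2 else 3)"
    using heisenberg_in_parabolic_of_degree_iff [OF as(1-4)] by simp
  with as show thesis by (rule that)
qed

end

theorem theorem1p4:
  fixes e :: "'a::complex_hilbert"
    and S :: "'a \<times> complex \<Rightarrow> 'a \<times> complex"
    and l :: complex
  assumes "norm e = 1"
    and "S \<in> G_hat e"
    and "parabolic_hat e S"
    and "op_spectrum S = {l}"
  shows "(\<exists>T \<in> conj_class (G_hat e) S. heisenberg_translation e T)
    \<and> (\<exists>K u. splitting e l S K u \<and>
          (is_min_poly_on S K ([:- l, 1:] ^ 2) \<or> is_min_poly_on S K ([:- l, 1:] ^ 3)))
    \<and> (\<exists>T1 \<in> parabolic_of_degree e l 2. \<exists>T2 \<in> parabolic_of_degree e l 2.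
          conj_class (G_hat e) T1 \<inter> conj_class (G_hat e) T2 = {} \<and>
          parabolic_of_degree e l 2 = conj_class (G_hat e) T1 \<union> conj_class (G_hat e) T2)
    \<and> (\<forall>T \<in> parabolic_of_degree e l 3.
          parabolic_of_degree e l 3 = conj_class (G_hat e) T)"
proof -
  interpret unit_vector e
    by unfold_locales (rule assms)
  obtain a s where l: "cmod l = 1" and as: "cinner a e = 0" "Re s = (norm a)\<^sup>2 / 2" "s \<noteq> 0"
      "heisenberg e l a s \<in> conj_class (G_hat e) S"
    using assms(2-4) by (rule parabolic_conj_heisenberg)
  note H = heisenberg_in_G_hat [OF l as(1,2)]
  have 1: "heisenberg_translation e (heisenberg e l a s)"
    using H l as unfolding heisenberg_translation_def by blast
  obtain g where g: "g \<in> G_hat e" "\<And>p. g (heisenberg e l a s p) = S (g p)"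
    using conj_class_sym [OF as(4)] unfolding conj_class_iff by blast
  note split = splitting_heisenberg [OF l as(1-3)]
  have 2: "splitting e l S (g ` split_space a) (g (coord 1 0 0))"
    using conj_splitting [OF H g split] .
  have 3: "is_min_poly_on S (g ` split_space a) ([:- l, 1:] ^ (if a = 0 then 2 else 3))"
    using conj_is_min_poly_on [OF H g is_min_poly_on_heisenberg [OF l as(1-3) split]] .
  \<comment> \<open>Membership follows from \<open>cmod l = 1\<close>, so both representatives are
    available whichever degree \<open>S\<close> itself has.\<close>
  have T: "heisenberg e l 0 \<i> \<in> parabolic_of_degree e l 2" "heisenberg e l 0 (- \<i>) \<in> parabolic_of_degree e l 2"
    using heisenberg_in_parabolic_of_degree_iff [OF l, of 0] by simp_all
  have 4: "parabolic_of_degree e l 2 =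
      conj_class (G_hat e) (heisenberg e l 0 \<i>) \<union> conj_class (G_hat e) (heisenberg e l 0 (- \<i>))"
  proof
    show "conj_class (G_hat e) (heisenberg e l 0 \<i>) \<union> conj_class (G_hat e) (heisenberg e l 0 (- \<i>))
        \<subseteq> parabolic_of_degree e l 2"
      using T parabolic_of_degree_conj by blast
    show "parabolic_of_degree e l 2 \<subseteq>
        conj_class (G_hat e) (heisenberg e l 0 \<i>) \<union> conj_class (G_hat e) (heisenberg e l 0 (- \<i>))"
    proof
      fix R assume "R \<in> parabolic_of_degree e l 2"
      then obtain b t where bt: "Re t = (norm b)\<^sup>2 / 2" "t \<noteq> 0"
          "heisenberg e l b t \<in> conj_class (G_hat e) R" "2 = (if b = 0 then 2 else 3 :: nat)"
        by (rule parabolic_of_degree_conj_heisenberg)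
      then have b: "b = 0" by (simp split: if_splits)
      then show "R \<in> conj_class (G_hat e) (heisenberg e l 0 \<i>) \<union> conj_class (G_hat e) (heisenberg e l 0 (- \<i>))"
        using heisenberg_conj_of_imaginary [of t l] bt conj_class_trans [OF _ conj_class_sym [OF bt(3)]]
        by auto
    qed
  qed
  \<comment> \<open>The claim starts from a given member because the set is empty when
    \<open>e\<close> spans the space: every admissible \<open>a\<close> is then 0.\<close>
  have 5: "parabolic_of_degree e l 3 = conj_class (G_hat e) T" if T: "T \<in> parabolic_of_degree e l 3" for T
  proof
    show "conj_class (G_hat e) T \<subseteq> parabolic_of_degree e l 3"
      using T parabolic_of_degree_conj by blast
    obtain b t where bt: "cinner b e = 0" "Re t = (norm b)\<^sup>2 / 2"
        "heisenberg e l b t \<in> conj_class (G_hat e) T" "3 = (if b = 0 then 2 else 3 :: nat)"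
      using T by (rule parabolic_of_degree_conj_heisenberg)
    then have b: "b \<noteq> 0" by auto
    show "parabolic_of_degree e l 3 \<subseteq> conj_class (G_hat e) T"
    proof
      fix R assume "R \<in> parabolic_of_degree e l 3"
      then obtain b' t' where bt': "cinner b' e = 0" "Re t' = (norm b')\<^sup>2 / 2"
          "heisenberg e l b' t' \<in> conj_class (G_hat e) R" "3 = (if b' = 0 then 2 else 3 :: nat)"
        by (rule parabolic_of_degree_conj_heisenberg)
      then have "b' \<noteq> 0" by auto
      then have "heisenberg e l b' t' \<in> conj_class (G_hat e) (heisenberg e l b t)"
        using b bt bt' by (intro heisenberg_conj_of_nonzero)
      then show "R \<in> conj_class (G_hat e) T"
        using bt(3) bt'(3) conj_class_sym conj_class_trans by blast
    qed
  qed
  have "is_min_poly_on S (g ` split_space a) ([:- l, 1:] ^ 2) \<or>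
      is_min_poly_on S (g ` split_space a) ([:- l, 1:] ^ 3)"
    using 3 by (cases "a = 0") (simp_all only: if_True if_False simp_thms)
  then have part2: "\<exists>K u. splitting e l S K u \<and>
      (is_min_poly_on S K ([:- l, 1:] ^ 2) \<or> is_min_poly_on S K ([:- l, 1:] ^ 3))"
    using 2 by blast
  have "l \<noteq> 0" using l by auto
  then have part3: "\<exists>T1 \<in> parabolic_of_degree e l 2. \<exists>T2 \<in> parabolic_of_degree e l 2.
      conj_class (G_hat e) T1 \<inter> conj_class (G_hat e) T2 = {} \<and>
      parabolic_of_degree e l 2 = conj_class (G_hat e) T1 \<union> conj_class (G_hat e) T2"
    by (intro bexI [OF _ T(1)] bexI [OF _ T(2)] conjI 4 heisenberg_imaginary_disjoint)
  show ?thesis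
    by (intro conjI bexI [where x = "heisenberg e l a s", OF _ as(4)] 1 ballI part2 part3 5)
qed

end
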